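(* (Lebesgue dominated convergence theorem.) Let $\Sigma$ be an abstract $\sigma$-algebra with measure $\mu$. Suppose $f$ and $f_n$ ($n\in\mathbb{N}$) are complex measurable functions on $\Sigma$ such that $$f=\lim_{n\to\infty}f_n,$$ and suppose there exists an integrable non-negative measurable function $g$ on $\Sigma$ such that $|f_n|\le g$ for all $n$. Then $f$ is integrable, $$\lim_{n\to\infty}\int|f_n-f|\,d\mu=0,$$ and $$\lim_{n\to\infty}\int f_n\,d\mu=\int f\,d\mu.$$
   Context: An abstract $\sigma$-algebra is a Boolean algebra in which all countable joins exist. A morphism of abstract $\sigma$-algebras is a map preserving order, $0$, $1$, complements and countable joins. A measure on $\Sigma$ is a function $\mu:\Sigma\to[0,\infty]$ with $\mu(0)=0$ and $\mu(\bigvee_{i=0}^\infty a_i)=\sum_{i=0}^\infty\mu(a_i)$ whenever $a_i\wedge a_j=0$ for $i\neq j$. A $\sigma$-frame is a lattice with $0,1$, finite meets and countable joins, with finite meets distributing over countable joins. For $Y=[0,\infty],\mathbb{R},\mathbb{C}$ let $\mathcal{B}(Y)$ be the universal abstract $\sigma$-algebra on the $\sigma$-frame of open subsets of $Y$: every $\sigma$-frame morphism from the open sets of $Y$ to an abstract $\sigma$-algebra extends uniquely to a morphism of abstract $\sigma$-algebras on $\mathcal{B}(Y)$. Write $\mathcal{B}=\mathcal{B}([0,\infty])$. Open sets are regarded as elements of $\mathcal{B}(Y)$. In $\mathcal{B}$, $[0,t]$ is the complement of $(t,\infty]$ and $[t,\infty]$ the complement of $[0,t)$. A non-negative (resp.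 real, complex) measurable function on $\Sigma$ is a morphism of abstract $\sigma$-algebras from $\mathcal{B}$ (resp. $\mathcal{B}(\mathbb{R})$, $\mathcal{B}(\mathbb{C})$) to $\Sigma$. Continuous operations act on measurable functions. A continuous unary map $h:Y\to Y'$ gives $h(f)(U)=f(h^{-1}(U))$ for $U$ open. A continuous binary operation $h:Y\times Y\to Y'$ gives $h(f,g)(U)=\bigvee\{f(V)\wedge g(W)\}$ over basic open rectangles $V\times W\subseteq h^{-1}(U)$ from a countable base. In particular $|f|$ (non-negative measurable), $f-g$, $\min$, $\max$, and real and imaginary parts are defined. For non-negative measurable functions, $f\le g$ means $f([0,t])\ge g([0,t])$ for all $t\in[0,\infty]$. $\inf_{i\ge k}f_i$ is the non-negative measurable function with $(\inf_{i\ge k}f_i)([t,\infty])=\bigwedge_{i\ge k}f_i([t,\infty])$, and $\sup_{i\ge k}f_i$ is the one with $(\sup_{i\ge k}f_i)([0,t])=\bigwedge_{i\ge k}f_i([0,t])$. $\liminf_n f_n=\sup_k\inf_{i\ge k}f_i$ and $\limsup_n f_n=\inf_k\sup_{i\ge k}f_i$. For complex measurable functions, $f=\lim_n f_n$ means $\limsup_n|f_n-f|=0$, where $0$ is the constant zero function (sending an open $U$ to $1$ if $0\in U$ and to $0$ otherwise). Integral: a simple function is a morphism $f:\mathcal{B}\to\Sigma$ that factors as $f=s\circ\chi$ with morphisms $\chi:\mathcal{B}\to 2^{\{0,\dots,n\}}$, $s:2^{\{0,\dots,n\}}\to\Sigma$. Such a $\chi$ is induced by points $x_0,\dots,x_n\in[0,\infty]$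 (that is, $\chi(U)=\{i:x_i\in U\}$ for $U$ open), and $\int f\,d\mu=\sum_{i=0}^n\mu(s(\{i\}))x_i$ with $0\cdot\infty=0$. For an arbitrary non-negative measurable $f$, $\int f\,d\mu=\sup\{\int g\,d\mu:g\le f,\ g\text{ simple}\}$. A non-negative measurable $g$ is integrable if $\int g\,d\mu<\infty$, and a complex measurable $f$ is integrable if $\int|f|\,d\mu<\infty$. For integrable $f=u+iv$ with $u,v$ real measurable, $\int f\,d\mu=\int u^+d\mu-\int u^-d\mu+i\int v^+d\mu-i\int v^-d\mu$, where $u^+=\max(u,0)$ and $u^-=-\min(u,0)$ (and similarly for $v$). *)

theory Defs
  imports "HOL-Analysis.Analysis" "HOL-Library.Countable_Complete_Lattices"
begin

section \<open>Abstract sigma-algebras and their morphisms\<close>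

text \<open>
  \<^const>\<open>Sup\<close> and \<^const>\<open>Inf\<close> are only constrained on countable sets, where they are the joins
  and meets. The degenerate algebra with \<open>bot = top\<close> is allowed.
\<close>

class abstract_sigma_algebra = boolean_algebra + countable_complete_lattice

instance set :: (type) abstract_sigma_algebra ..

text \<open>
  For an element \<open>e\<close>, the elements below \<open>e\<close> form an abstract sigma-algebra with largest
  element \<open>e\<close> and complement \<open>\<lambda>x. e - x\<close>. Morphisms are defined between such algebras, so that
  the algebra of all subsets of \<open>{0, ..., n}\<close>, which consists of the elements of type
  \<^typ>\<open>nat set\<close> below \<open>{..n}\<close>, is covered for a variable \<open>n\<close>. The case
  \<open>e = top\<close> is that of the whole algebra.
\<close>

definition sigma_morphism_below ::
  "'a::abstract_sigma_algebra \<Rightarrow> 'b::abstract_sigma_algebra \<Rightarrow> ('a \<Rightarrow> 'b) \<Rightarrow> bool"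
  where "sigma_morphism_below e e' f \<longleftrightarrow>
    (\<forall>x\<le>e. f x \<le> e') \<and>
    (\<forall>x y. x \<le> y \<and> y \<le> e \<longrightarrow> f x \<le> f y) \<and>
    f bot = bot \<and> f e = e' \<and>
    (\<forall>x\<le>e. f (e - x) = e' - f x) \<and>
    (\<forall>x::nat \<Rightarrow> 'a. (\<forall>i. x i \<le> e) \<longrightarrow> f (SUP i. x i) = (SUP i. f (x i)))"

abbreviation sigma_morphism ::
  "('a::abstract_sigma_algebra \<Rightarrow> 'b::abstract_sigma_algebra) \<Rightarrow> bool"
  where "sigma_morphism \<equiv> sigma_morphism_below top top"

lemma sigma_morphism_iff:
  "sigma_morphism f \<longleftrightarrow> mono f \<and> f bot = bot \<and> f top = top \<and> (\<forall>x. f (- x) = - f x) \<and>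
    (\<forall>x::nat \<Rightarrow> _. f (SUP i. x i) = (SUP i. f (x i)))"
  by (simp add: sigma_morphism_below_def mono_def diff_eq)

definition is_measure :: "('s::abstract_sigma_algebra \<Rightarrow> ennreal) \<Rightarrow> bool"
  where "is_measure \<mu> \<longleftrightarrow> \<mu> bot = 0 \<and>
    (\<forall>a::nat \<Rightarrow> 's. (\<forall>i j. i \<noteq> j \<longrightarrow> inf (a i) (a j) = bot) \<longrightarrow> \<mu> (SUP i. a i) = (\<Sum>i. \<mu> (a i)))"


section \<open>The universal abstract sigma-algebra on the open sets of a space\<close>

definition open_frame_morphism :: "('y::topological_space set \<Rightarrow> 's::abstract_sigma_algebra) \<Rightarrow> bool"
  where "open_frame_morphism \<phi> \<longleftrightarrow>
    \<phi> {} = bot \<and> \<phi> UNIV = top \<and>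
    (\<forall>U V. open U \<and> open V \<longrightarrow> \<phi> (U \<inter> V) = inf (\<phi> U) (\<phi> V)) \<and>
    (\<forall>U::nat \<Rightarrow> 'y set. (\<forall>i. open (U i)) \<longrightarrow> \<phi> (\<Union>i. U i) = (SUP i. \<phi> (U i)))"

text \<open>
  The universal algebra is the Lindenbaum algebra of formal expressions in the open sets:
  \<open>bt_le\<close> is the preorder generated by the laws of an abstract sigma-algebra and by the
  relations between open sets that hold in the sigma-frame. The universal property is
  proved below as \<open>universal_property\<close>.
\<close>

datatype 'y bterm = Gen "'y set" | Neg "'y bterm" | Meet "'y bterm" "'y bterm" | Join "nat \<Rightarrow> 'y bterm"

text \<open>
  Only open sets are meant to be generators; rule \<open>not_open\<close> makes the expressions \<open>Gen U\<close>
  for other sets \<open>U\<close> equal to \<open>0\<close>.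
\<close>

inductive bt_le :: "'y::topological_space bterm \<Rightarrow> 'y bterm \<Rightarrow> bool" where
  refl: "bt_le a a"
| trans: "bt_le a b \<Longrightarrow> bt_le b c \<Longrightarrow> bt_le a c"
| meet1: "bt_le (Meet a b) a"
| meet2: "bt_le (Meet a b) b"
| meet_greatest: "bt_le c a \<Longrightarrow> bt_le c b \<Longrightarrow> bt_le c (Meet a b)"
| join_upper: "bt_le (t i) (Join t)"
| join_least: "(\<And>i. bt_le (t i) c) \<Longrightarrow> bt_le (Join t) c"
| distrib: "bt_le (Meet a (Join t)) (Join (\<lambda>i. Meet a (t i)))"
| bot: "bt_le (Gen {}) a"
| top: "bt_le a (Gen UNIV)"
| neg_meet: "bt_le (Meet a (Neg a)) (Gen {})"
| neg_join: "bt_le (Gen UNIV) (Join (\<lambda>i. if i = 0 then a else Neg a))"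
| gen_inter1: "open U \<Longrightarrow> open V \<Longrightarrow> bt_le (Gen (U \<inter> V)) (Meet (Gen U) (Gen V))"
| gen_inter2: "open U \<Longrightarrow> open V \<Longrightarrow> bt_le (Meet (Gen U) (Gen V)) (Gen (U \<inter> V))"
| gen_union1: "(\<And>i::nat. open (W i)) \<Longrightarrow> bt_le (Gen (\<Union>i. W i)) (Join (\<lambda>i. Gen (W i)))"
| gen_union2: "(\<And>i::nat. open (W i)) \<Longrightarrow> bt_le (Join (\<lambda>i. Gen (W i))) (Gen (\<Union>i. W i))"
| not_open: "\<not> open U \<Longrightarrow> bt_le (Gen U) (Gen {})"

definition bt_eq :: "'y::topological_space bterm \<Rightarrow> 'y bterm \<Rightarrow> bool"
  where "bt_eq a b \<longleftrightarrow> bt_le a b \<and> bt_le b a"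

quotient_type (overloaded) 'y universal_algebra = "'y::topological_space bterm" / bt_eq
proof (rule equivpI)
  show "reflp bt_eq" by (simp add: reflp_def bt_eq_def bt_le.refl)
  show "symp bt_eq" by (simp add: symp_def bt_eq_def)
  show "transp bt_eq" by (rule transpI) (auto simp: bt_eq_def elim: bt_le.trans)
qed

lemma bt_join_mono: "(\<And>i. bt_le (s i) (t i)) \<Longrightarrow> bt_le (Join s) (Join t)"
  by (rule bt_le.join_least) (rule bt_le.trans[OF _ bt_le.join_upper])

lemma bt_meet_mono: "bt_le a b \<Longrightarrow> bt_le c d \<Longrightarrow> bt_le (Meet a c) (Meet b d)"
  by (rule bt_le.meet_greatest) (erule bt_le.trans[rotated], rule bt_le.meet1 bt_le.meet2)+

lemma bt_neg_antimono:
  assumes "bt_le a b" shows "bt_le (Neg b) (Neg a)"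
proof -
  let ?j = "\<lambda>i::nat. if i = 0 then a else Neg a"
  have "bt_le (Meet (Neg b) (?j i)) (Neg a)" for i
  proof (cases "i = 0")
    case True
    have "bt_le (Meet (Neg b) a) (Meet b (Neg b))"
      by (rule bt_le.meet_greatest[OF bt_le.trans[OF bt_le.meet2 assms] bt_le.meet1])
    from bt_le.trans[OF this bt_le.trans[OF bt_le.neg_meet bt_le.bot]] True
    show ?thesis by simp
  qed (simp add: bt_le.meet2)
  from bt_le.trans[OF bt_le.distrib bt_le.join_least[OF this]]
  have "bt_le (Meet (Neg b) (Join ?j)) (Neg a)" .
  moreover have "bt_le (Neg b) (Meet (Neg b) (Join ?j))"
    by (rule bt_le.meet_greatest[OF bt_le.refl bt_le.trans[OF bt_le.top bt_le.neg_join]])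
  ultimately show ?thesis by (rule bt_le.trans[rotated])
qed

lift_definition open_elem :: "'y::topological_space set \<Rightarrow> 'y universal_algebra" is Gen .

lift_definition ua_join :: "(nat \<Rightarrow> 'y::topological_space universal_algebra) \<Rightarrow> 'y universal_algebra"
  is Join
  by (simp add: bt_eq_def rel_fun_def bt_join_mono)

instantiation universal_algebra :: (topological_space) abstract_sigma_algebra
begin

lift_definition less_eq_universal_algebra :: "'a universal_algebra \<Rightarrow> 'a universal_algebra \<Rightarrow> bool"
  is bt_le
proof -
  fix a b c d :: "'a bterm"
  assume "bt_eq a b" "bt_eq c d"
  then have ab: "bt_le a b" "bt_le b a" and cd: "bt_le c d" "bt_le d c" by (auto simp: bt_eq_def)
  show "bt_le a c = bt_le b d"
    using bt_le.trans[OF ab(2) bt_le.trans[OF _ cd(1)]]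
      bt_le.trans[OF ab(1) bt_le.trans[OF _ cd(2)]] by blast
qed

definition less_universal_algebra :: "'a universal_algebra \<Rightarrow> 'a universal_algebra \<Rightarrow> bool"
  where "less_universal_algebra a b \<longleftrightarrow> a \<le> b \<and> \<not> b \<le> a"

lift_definition bot_universal_algebra :: "'a universal_algebra" is "Gen {}" .

lift_definition top_universal_algebra :: "'a universal_algebra" is "Gen UNIV" .

lift_definition uminus_universal_algebra :: "'a universal_algebra \<Rightarrow> 'a universal_algebra"
  is Neg by (simp add: bt_eq_def bt_neg_antimono)

lift_definition inf_universal_algebra ::
  "'a universal_algebra \<Rightarrow> 'a universal_algebra \<Rightarrow> 'a universal_algebra"
  is Meet by (simp add: bt_eq_def bt_meet_mono)

definition sup_universal_algebra ::
  "'a universal_algebra \<Rightarrow> 'a universal_algebra \<Rightarrow> 'a universal_algebra"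
  where "sup_universal_algebra a b = ua_join (\<lambda>i. if i = 0 then a else b)"

definition minus_universal_algebra ::
  "'a universal_algebra \<Rightarrow> 'a universal_algebra \<Rightarrow> 'a universal_algebra"
  where "minus_universal_algebra a b = inf a (- b)"

definition Sup_universal_algebra :: "'a universal_algebra set \<Rightarrow> 'a universal_algebra"
  where "Sup_universal_algebra A = (if A = {} then bot else ua_join (from_nat_into A))"

definition Inf_universal_algebra :: "'a universal_algebra set \<Rightarrow> 'a universal_algebra"
  where "Inf_universal_algebra A = - Sup (uminus ` A)"

lemma ua_order:
  fixes a b c :: "'a universal_algebra"
  shows "a \<le> a" "a \<le> b \<Longrightarrow> b \<le> c \<Longrightarrow> a \<le> c" "a \<le> b \<Longrightarrow> b \<le> a \<Longrightarrow> a = b"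
    "inf a b \<le> a" "inf a b \<le> b" "c \<le> a \<Longrightarrow> c \<le> b \<Longrightarrow> c \<le> inf a b"
    "bot \<le> a" "a \<le> top" "inf a (- a) \<le> bot" "top \<le> sup a (- a)"
    "b \<le> a \<Longrightarrow> - a \<le> - b"
proof -
  show "top \<le> sup a (- a)"
    unfolding sup_universal_algebra_def
  proof transfer
    fix a :: "'a bterm"
    show "bt_le (Gen UNIV) (Join (\<lambda>i. if i = 0 then a else Neg a))"
      by (rule bt_le.neg_join)
  qed
next
  show "a \<le> b \<Longrightarrow> b \<le> c \<Longrightarrow> a \<le> c" by transfer (rule bt_le.trans)
qed (transfer, simp add: bt_eq_def bt_le.refl bt_le.meet1 bt_le.meet2 bt_le.meet_greatest
      bt_le.bot bt_le.top bt_le.neg_meet bt_neg_antimono)+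

lemma ua_join:
  fixes t :: "nat \<Rightarrow> 'a universal_algebra"
  shows ua_join_upper: "t i \<le> ua_join t"
    and ua_join_least: "(\<And>i. t i \<le> c) \<Longrightarrow> ua_join t \<le> c"
    and ua_join_distrib: "inf a (ua_join t) \<le> ua_join (\<lambda>i. inf a (t i))"
  by (transfer, simp add: bt_le.join_upper bt_le.join_least bt_le.distrib)+

lemma ua_Sup:
  fixes A :: "'a universal_algebra set"
  assumes "countable A"
  shows ua_Sup_upper: "x \<in> A \<Longrightarrow> x \<le> Sup A"
    and ua_Sup_least: "(\<And>x. x \<in> A \<Longrightarrow> x \<le> c) \<Longrightarrow> Sup A \<le> c"
proof -
  show "x \<le> Sup A" if "x \<in> A"
  proof -
    from from_nat_into_surj[OF assms that] obtain i where "from_nat_into A i = x" by blast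
    with ua_join_upper[of "from_nat_into A" i] that show ?thesis
      by (auto simp: Sup_universal_algebra_def)
  qed
  show "Sup A \<le> c" if "\<And>x. x \<in> A \<Longrightarrow> x \<le> c"
    using that by (simp add: Sup_universal_algebra_def from_nat_into ua_join_least ua_order(7))
qed

instance
proof -
  have sup_upper: "a \<le> sup a b" "b \<le> sup a b" for a b :: "'a universal_algebra"
    using ua_join_upper[of "\<lambda>i. if i = 0 then a else b" 0]
      ua_join_upper[of "\<lambda>i. if i = 0 then a else b" 1]
    by (simp_all add: sup_universal_algebra_def)
  have sup_least: "sup a b \<le> c" if "a \<le> c" "b \<le> c" for a b c :: "'a universal_algebra"
    using that by (simp add: sup_universal_algebra_def ua_join_least)
  have "class.lattice inf (\<le>) (<) (sup :: 'a universal_algebra \<Rightarrow> _)"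
  proof
    fix a b c :: "'a universal_algebra"
    show "a \<le> b \<Longrightarrow> b \<le> c \<Longrightarrow> a \<le> c" by (rule ua_order(2))
    show "a \<le> b \<Longrightarrow> b \<le> a \<Longrightarrow> a = b" by (rule ua_order(3))
    show "a \<le> b \<Longrightarrow> a \<le> c \<Longrightarrow> a \<le> inf b c" by (rule ua_order(6))
    show "b \<le> a \<Longrightarrow> c \<le> a \<Longrightarrow> sup b c \<le> a" by (rule sup_least)
  qed (simp_all add: less_universal_algebra_def sup_upper ua_order(1,4,5))
  then interpret L: lattice inf "(\<le>)" "(<)" "sup :: 'a universal_algebra \<Rightarrow> _" .
  have distr: "inf a (sup b c) = sup (inf a b) (inf a c)" for a b c :: "'a universal_algebra"
  proof (rule L.order.antisym)
    have "inf a (sup b c) \<le> ua_join (\<lambda>i. inf a (if i = 0 then b else c))"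
      unfolding sup_universal_algebra_def by (rule ua_join_distrib)
    also have "(\<lambda>i::nat. inf a (if i = 0 then b else c)) = (\<lambda>i. if i = 0 then inf a b else inf a c)"
      by auto
    finally show "inf a (sup b c) \<le> sup (inf a b) (inf a c)"
      by (simp add: sup_universal_algebra_def)
    show "sup (inf a b) (inf a c) \<le> inf a (sup b c)"
      by (intro sup_least ua_order(6) ua_order(4) ua_order(2)[OF ua_order(5)] sup_upper)
  qed
  have compl1: "inf a (- a) = bot" and compl2: "sup a (- a) = top" for a :: "'a universal_algebra"
    by (rule ua_order(3); rule ua_order)+
  have inf_top: "inf a top = a" and sup_bot: "sup a bot = a" for a :: "'a universal_algebra"
    by (simp_all add: L.inf_absorb1 L.sup_absorb1 ua_order(7,8))
  have negneg: "- (- a) = a" for a :: "'a universal_algebra"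
  proof -
    have "- (- a) = sup (inf (- (- a)) a) (inf (- (- a)) (- a))"
      by (simp add: compl2 inf_top flip: distr)
    also have "\<dots> = sup (inf a (- (- a))) (inf a (- a))"
      by (simp add: compl1 L.inf.commute[of "- (- a)"])
    also have "\<dots> = a"
      using L.sup.commute[of "- (- a)" "- a"] by (simp add: compl2 inf_top flip: distr)
    finally show ?thesis .
  qed
  have neg_bot: "- bot = (top :: 'a universal_algebra)"
    using compl2[of bot] L.sup.commute[of bot "- bot"] sup_bot[of "- bot"] by simp
  show "OFCLASS('a universal_algebra, abstract_sigma_algebra_class)"
  proof
    fix a b c :: "'a universal_algebra" and A :: "'a universal_algebra set"
    show "a \<le> b \<Longrightarrow> b \<le> c \<Longrightarrow> a \<le> c" by (rule ua_order(2))
    show "a \<le> b \<Longrightarrow> b \<le> a \<Longrightarrow> a = b" by (rule ua_order(3))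
    show "a \<le> b \<Longrightarrow> a \<le> c \<Longrightarrow> a \<le> inf b c" by (rule ua_order(6))
    show "b \<le> a \<Longrightarrow> c \<le> a \<Longrightarrow> sup b c \<le> a" by (rule sup_least)
    show "sup a (inf b c) = inf (sup a b) (sup a c)" by (rule L.distrib_imp1) (rule distr)
    show "a \<le> Sup A" if "countable A" "a \<in> A" using that by (rule ua_Sup_upper)
    show "Sup A \<le> c" if "countable A" "\<And>x. x \<in> A \<Longrightarrow> x \<le> c" using that by (rule ua_Sup_least)
    show "Inf A \<le> a" if "countable A" "a \<in> A"
      using ua_order(11)[OF ua_Sup_upper[of "uminus ` A" "- a"]] that
      by (simp add: Inf_universal_algebra_def negneg)
    show "c \<le> Inf A" if "countable A" "\<And>x. x \<in> A \<Longrightarrow> c \<le> x"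
    proof -
      have "Sup (uminus ` A) \<le> - c"
      proof (rule ua_Sup_least)
        fix x assume "x \<in> uminus ` A"
        then obtain y where "y \<in> A" "x = - y" by blast
        with that(2) show "x \<le> - c" by (simp add: ua_order(11))
      qed (use that in simp)
      from ua_order(11)[OF this] show ?thesis
        by (simp add: Inf_universal_algebra_def negneg)
    qed
  qed (simp_all add: less_universal_algebra_def minus_universal_algebra_def
      Sup_universal_algebra_def Inf_universal_algebra_def neg_bot compl1 compl2
      sup_upper ua_order(1,4,5,7,8))
qed

end

lemma ua_join_eq_SUP: "ua_join x = (SUP i. x i)"
  by (intro order.antisym ua_join_least ccSUP_least ccSUP_upper ua_join_upper) simp_all

lemma sup_eq_SUP_nat: "sup a b = (SUP i::nat. if i = 0 then a else b)"
  for a b :: "'a::abstract_sigma_algebra"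
proof (rule order.antisym)
  show "sup a b \<le> (SUP i::nat. if i = 0 then a else b)"
    using ccSUP_upper[of UNIV "0::nat" "\<lambda>i. if i = 0 then a else b"]
      ccSUP_upper[of UNIV "1::nat" "\<lambda>i. if i = 0 then a else b"] by simp
  show "(SUP i::nat. if i = 0 then a else b) \<le> sup a b"
    by (rule ccSUP_least) auto
qed

lemma inf_SUP_le: "inf a (SUP i::nat. t i) \<le> (SUP i. inf a (t i))"
  for a :: "'a::abstract_sigma_algebra"
proof -
  have "(SUP i. t i) \<le> sup (- a) (SUP i. inf a (t i))"
  proof (rule ccSUP_least)
    fix i :: nat
    have "inf (t i) a \<le> (SUP i. inf a (t i))"
      using ccSUP_upper[of UNIV i "\<lambda>i. inf a (t i)"] by (simp add: inf.commute)
    then show "t i \<le> sup (- a) (SUP i. inf a (t i))" by (simp only: shunt1)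
  qed simp
  then have "inf (SUP i. t i) a \<le> (SUP i. inf a (t i))" by (simp only: shunt1)
  then show ?thesis by (simp only: inf.commute)
qed

lemma sigma_morphism_sup:
  assumes "sigma_morphism f"
  shows "f (sup a b) = sup (f a) (f b)"
proof -
  have "f (sup a b) = (SUP i::nat. f (if i = 0 then a else b))"
    using assms unfolding sigma_morphism_iff sup_eq_SUP_nat[of a b] by blast
  then show ?thesis by (simp only: if_distrib[of f] sup_eq_SUP_nat[symmetric])
qed

lemma sigma_morphism_inf: "sigma_morphism f \<Longrightarrow> f (inf a b) = inf (f a) (f b)"
  using sigma_morphism_sup[of f "- a" "- b"] unfolding sigma_morphism_iff
  by (metis compl_sup double_compl)

lemma open_frame_morphism_open_elem: "open_frame_morphism open_elem"
proof -
  have "open_elem (U \<inter> V) = inf (open_elem U) (open_elem V)" if "open U" "open V" for U V :: "'a set"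
    using that by transfer (simp add: bt_eq_def bt_le.gen_inter1 bt_le.gen_inter2)
  moreover have "open_elem (\<Union>i. U i) = (SUP i. open_elem (U i))" if "\<And>i. open (U i)" for U :: "nat \<Rightarrow> 'a set"
    unfolding ua_join_eq_SUP[symmetric] using that
    by transfer (simp add: bt_eq_def bt_le.gen_union1 bt_le.gen_union2)
  moreover have "open_elem {} = (bot :: 'a universal_algebra)"
    "open_elem UNIV = (top :: 'a universal_algebra)"
    by (transfer, simp add: bt_eq_def bt_le.refl)+
  ultimately show ?thesis by (simp add: open_frame_morphism_def)
qed

primrec bt_eval :: "('y::topological_space set \<Rightarrow> 's::abstract_sigma_algebra) \<Rightarrow> 'y bterm \<Rightarrow> 's" where
  "bt_eval \<phi> (Gen U) = (if open U then \<phi> U else bot)"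
| "bt_eval \<phi> (Neg a) = - bt_eval \<phi> a"
| "bt_eval \<phi> (Meet a b) = inf (bt_eval \<phi> a) (bt_eval \<phi> b)"
| "bt_eval \<phi> (Join t) = (SUP i. bt_eval \<phi> (t i))"

lemma bt_eval_mono:
  assumes "open_frame_morphism \<phi>"
  shows "bt_le a b \<Longrightarrow> bt_eval \<phi> a \<le> bt_eval \<phi> b"
proof (induction rule: bt_le.induct)
  case (join_upper t i)
  then show ?case using ccSUP_upper[of UNIV i "\<lambda>i. bt_eval \<phi> (t i)"] by simp
next
  case (join_least t c)
  then show ?case by (simp add: ccSUP_least)
next
  case (distrib a t)
  then show ?case by (simp add: inf_SUP_le)
next
  case (neg_join a)
  have "(\<lambda>i::nat. bt_eval \<phi> (if i = 0 then a else Neg a)) =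
      (\<lambda>i. if i = 0 then bt_eval \<phi> a else - bt_eval \<phi> a)" by auto
  then have "bt_eval \<phi> (Join (\<lambda>i. if i = 0 then a else Neg a)) = top"
    by (simp only: bt_eval.simps sup_eq_SUP_nat[symmetric]) simp
  then show ?case by (simp only: top_greatest)
qed (use assms in \<open>auto simp: open_frame_morphism_def open_Union\<close>)

theorem universal_property:
  fixes \<phi> :: "'y::topological_space set \<Rightarrow> 's::abstract_sigma_algebra"
  assumes "open_frame_morphism \<phi>"
  shows "\<exists>!F. sigma_morphism F \<and> (\<forall>U. open U \<longrightarrow> F (open_elem U) = \<phi> U)"
proof (rule ex1I)
  define F where "F x = bt_eval \<phi> (rep_universal_algebra x)" for x
  have F_abs: "F (abs_universal_algebra a) = bt_eval \<phi> a" for a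
  proof -
    have "bt_eq (rep_universal_algebra (abs_universal_algebra a)) a"
      by (rule rep_abs_rsp_left[OF Quotient3_universal_algebra]) (simp add: bt_eq_def bt_le.refl)
    then show ?thesis
      unfolding F_def bt_eq_def by (auto intro!: order.antisym bt_eval_mono[OF assms])
  qed
  have abs_rep: "abs_universal_algebra (rep_universal_algebra x) = x" for x :: "'y universal_algebra"
    by (rule Quotient3_abs_rep[OF Quotient3_universal_algebra])
  have join: "F (SUP i. x i) = (SUP i. F (x i))" for x :: "nat \<Rightarrow> 'y universal_algebra"
  proof -
    have "(SUP i. x i) = abs_universal_algebra (Join (\<lambda>i. rep_universal_algebra (x i)))"
      by (simp add: ua_join_eq_SUP[symmetric] ua_join.abs_eq[symmetric] abs_rep comp_def)
    then show ?thesis by (simp add: F_abs) (simp add: F_def)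
  qed
  have "mono F"
  proof (rule monoI)
    fix x y :: "'y universal_algebra" assume "x \<le> y"
    then have "bt_le (rep_universal_algebra x) (rep_universal_algebra y)"
      by (metis abs_rep less_eq_universal_algebra.abs_eq)
    then show "F x \<le> F y" unfolding F_def by (rule bt_eval_mono[OF assms])
  qed
  moreover have "F (- x) = - F x" for x
    by (metis F_abs F_def abs_rep bt_eval.simps(2) uminus_universal_algebra.abs_eq)
  moreover have gen: "F (open_elem U) = \<phi> U" if "open U" for U
    using that by (simp add: open_elem.abs_eq F_abs)
  moreover have "F bot = bot" "F top = top"
    using gen[of "{}"] gen[of UNIV] assms open_frame_morphism_open_elem[where 'a='y]
    by (simp_all add: open_frame_morphism_def)
  ultimately show "sigma_morphism F \<and> (\<forall>U. open U \<longrightarrow> F (open_elem U) = \<phi> U)"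
    unfolding sigma_morphism_iff using join by blast
next
  fix F assume F: "sigma_morphism F \<and> (\<forall>U. open U \<longrightarrow> F (open_elem U) = \<phi> U)"
  have "F (abs_universal_algebra a) = bt_eval \<phi> a" for a
  proof (induction a)
    case (Gen U)
    show ?case
    proof (cases "open U")
      case False
      then have "open_elem U = open_elem {}"
        by transfer (simp add: bt_eq_def bt_le.not_open bt_le.bot)
      with F assms False show ?thesis
        by (simp add: open_elem.abs_eq[symmetric] open_frame_morphism_def)
    qed (use F in \<open>simp add: open_elem.abs_eq[symmetric]\<close>)
  next
    case (Neg a)
    with F show ?case by (simp add: uminus_universal_algebra.abs_eq[symmetric] sigma_morphism_iff)
  next
    case (Meet a b)
    with F show ?case by (simp add: inf_universal_algebra.abs_eq[symmetric] sigma_morphism_inf)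
  next
    case (Join t)
    have "abs_universal_algebra (Join t) = (SUP i. abs_universal_algebra (t i))"
      by (simp add: ua_join_eq_SUP[symmetric] ua_join.abs_eq[symmetric] comp_def)
    with F Join show ?case by (simp add: sigma_morphism_iff)
  qed
  then show "F = (\<lambda>x. bt_eval \<phi> (rep_universal_algebra x))"
    by (metis (no_types) Quotient3_abs_rep[OF Quotient3_universal_algebra] ext)
qed

definition sigma_extension ::
  "('y::topological_space set \<Rightarrow> 's::abstract_sigma_algebra) \<Rightarrow> 'y universal_algebra \<Rightarrow> 's"
  where "sigma_extension \<phi> = (THE F. sigma_morphism F \<and> (\<forall>U. open U \<longrightarrow> F (open_elem U) = \<phi> U))"

lemma sigma_extension:
  assumes "open_frame_morphism \<phi>"
  shows "sigma_morphism (sigma_extension \<phi>)"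
    and "open U \<Longrightarrow> sigma_extension \<phi> (open_elem U) = \<phi> U"
  using theI'[OF universal_property[OF assms]] by (simp_all add: sigma_extension_def)


section \<open>Measurable functions\<close>

text \<open>
  A measurable function on \<open>'s\<close> with values in \<open>'y\<close> is a \<open>sigma_morphism\<close> of this type;
  \<open>'y\<close> is \<^typ>\<open>ennreal\<close> (the space \<open>[0, \<infinity>]\<close>), \<^typ>\<open>real\<close> or \<^typ>\<open>complex\<close>.
\<close>

type_synonym ('y, 's) mfun = "'y universal_algebra \<Rightarrow> 's"

definition mf_const :: "'y::topological_space \<Rightarrow> ('y, 's::abstract_sigma_algebra) mfun"
  where "mf_const c = sigma_extension (\<lambda>U. if c \<in> U then top else bot)"

definition mf_unary :: "('y::topological_space \<Rightarrow> 'z::topological_space) \<Rightarrow>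
    ('y, 's::abstract_sigma_algebra) mfun \<Rightarrow> ('z, 's) mfun"
  where "mf_unary h f = sigma_extension (\<lambda>U. f (open_elem (h -` U)))"

definition mf_binary :: "('y::second_countable_topology \<Rightarrow> 'y \<Rightarrow> 'z::topological_space) \<Rightarrow>
    ('y, 's::abstract_sigma_algebra) mfun \<Rightarrow> ('y, 's) mfun \<Rightarrow> ('z, 's) mfun"
  where "mf_binary h f g =
    (let B = (SOME B::'y set set. countable B \<and> topological_basis B) in
      sigma_extension (\<lambda>U. Sup {inf (f (open_elem V)) (g (open_elem W)) | V W.
        V \<in> B \<and> W \<in> B \<and> (\<forall>x\<in>V. \<forall>y\<in>W. h x y \<in> U)}))"

lemma open_frame_morphism_const:
  "open_frame_morphism (\<lambda>U. if c \<in> U then top else bot :: 's::abstract_sigma_algebra)"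
proof -
  have "(if c \<in> (\<Union>i. U i) then top else bot) = (SUP i. if c \<in> U i then top else bot :: 's)"
    for U :: "nat \<Rightarrow> 'a set"
  proof (cases "\<exists>i. c \<in> U i")
    case True
    then obtain i where "c \<in> U i" by blast
    then have "top \<le> (SUP i. if c \<in> U i then top else bot :: 's)"
      using ccSUP_upper[of UNIV i "\<lambda>i. if c \<in> U i then top else bot :: 's"] by simp
    with True show ?thesis by (simp add: top_unique)
  qed simp
  then show ?thesis by (simp add: open_frame_morphism_def)
qed

lemma open_frame_morphism_unary:
  fixes h :: "'y::topological_space \<Rightarrow> 'z::topological_space"
  assumes "sigma_morphism f" and "continuous_on UNIV h"
  shows "open_frame_morphism (\<lambda>U. f (open_elem (h -` U)))"
proof -
  have vim: "open (h -` U)" if "open U" for U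
    using assms(2) that open_vimage by blast
  have f: "f bot = bot" "f top = top" "f (SUP i::nat. x i) = (SUP i. f (x i))" for x
    using assms(1) unfolding sigma_morphism_iff by blast+
  have inter: "open_elem (U \<inter> V) = inf (open_elem U) (open_elem V)" if "open U" "open V" for U V :: "'y set"
    using open_frame_morphism_open_elem that unfolding open_frame_morphism_def by blast
  have union: "open_elem (\<Union>i. U i) = (SUP i. open_elem (U i))" if "\<And>i. open (U i)" for U :: "nat \<Rightarrow> 'y set"
    using open_frame_morphism_open_elem that unfolding open_frame_morphism_def by blast
  have triv: "open_elem {} = (bot :: 'y universal_algebra)" "open_elem UNIV = (top :: 'y universal_algebra)"
    using open_frame_morphism_open_elem unfolding open_frame_morphism_def by blast+
  show ?thesis
    unfolding open_frame_morphism_def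
    by (simp add: vimage_UN inter union vim triv f sigma_morphism_inf[OF assms(1)])
qed

definition mf_abs :: "(complex, 's::abstract_sigma_algebra) mfun \<Rightarrow> (ennreal, 's) mfun"
  where "mf_abs = mf_unary (\<lambda>z. ennreal (cmod z))"

definition mf_diff ::
  "(complex, 's::abstract_sigma_algebra) mfun \<Rightarrow> (complex, 's) mfun \<Rightarrow> (complex, 's) mfun"
  where "mf_diff = mf_binary (-)"

text \<open>
  \<open>u\<^sup>+ = max u 0\<close> and \<open>u\<^sup>- = - min u 0\<close>. They are non-negative and are regarded as functions
  with values in \<open>[0, \<infinity>]\<close> by means of \<^const>\<open>ennreal\<close>, which is continuous and is the
  inclusion on \<open>[0, \<infinity>)\<close>.
\<close>

definition mf_pos :: "(real, 's::abstract_sigma_algebra) mfun \<Rightarrow> (ennreal, 's) mfun"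
  where "mf_pos u = mf_unary ennreal (mf_binary max u (mf_const 0))"

definition mf_neg :: "(real, 's::abstract_sigma_algebra) mfun \<Rightarrow> (ennreal, 's) mfun"
  where "mf_neg u = mf_unary ennreal (mf_unary uminus (mf_binary min u (mf_const 0)))"


section \<open>Order and limits\<close>

text \<open>The elements \<open>[0, t]\<close> and \<open>[t, \<infinity>]\<close>.\<close>

definition lower_elem :: "ennreal \<Rightarrow> ennreal universal_algebra"
  where "lower_elem t = - open_elem {t<..}"

definition upper_elem :: "ennreal \<Rightarrow> ennreal universal_algebra"
  where "upper_elem t = - open_elem {..<t}"

definition mf_le :: "(ennreal, 's::abstract_sigma_algebra) mfun \<Rightarrow> (ennreal, 's) mfun \<Rightarrow> bool"
  where "mf_le f g \<longleftrightarrow> (\<forall>t. g (lower_elem t) \<le> f (lower_elem t))"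

definition mf_INF :: "nat set \<Rightarrow> (nat \<Rightarrow> (ennreal, 's::abstract_sigma_algebra) mfun) \<Rightarrow> (ennreal, 's) mfun"
  where "mf_INF I F =
    (THE G. sigma_morphism G \<and> (\<forall>t. G (upper_elem t) = (INF i\<in>I. F i (upper_elem t))))"

definition mf_SUP :: "nat set \<Rightarrow> (nat \<Rightarrow> (ennreal, 's::abstract_sigma_algebra) mfun) \<Rightarrow> (ennreal, 's) mfun"
  where "mf_SUP I F =
    (THE G. sigma_morphism G \<and> (\<forall>t. G (lower_elem t) = (INF i\<in>I. F i (lower_elem t))))"

definition mf_limsup :: "(nat \<Rightarrow> (ennreal, 's::abstract_sigma_algebra) mfun) \<Rightarrow> (ennreal, 's) mfun"
  where "mf_limsup F = mf_INF UNIV (\<lambda>k. mf_SUP {k..} F)"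

definition mf_tendsto ::
  "(nat \<Rightarrow> (complex, 's::abstract_sigma_algebra) mfun) \<Rightarrow> (complex, 's) mfun \<Rightarrow> bool"
  where "mf_tendsto F f \<longleftrightarrow> mf_limsup (\<lambda>n. mf_abs (mf_diff (F n) f)) = mf_const 0"


section \<open>Integration\<close>

text \<open>
  A simple function factors through the algebra of subsets of \<open>{0, ..., n}\<close>. The first factor
  \<open>p\<close> is induced by points \<open>x 0, ..., x n\<close>, which give the values in \<open>simple_integral\<close>.
\<close>

definition simple_factorization ::
  "(ennreal, 's::abstract_sigma_algebra) mfun \<Rightarrow> nat \<Rightarrow> (ennreal universal_algebra \<Rightarrow> nat set) \<Rightarrow>
    (nat set \<Rightarrow> 's) \<Rightarrow> bool"
  where "simple_factorization f n p s \<longleftrightarrow>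
    sigma_morphism_below top {..n} p \<and> sigma_morphism_below {..n} top s \<and> f = s \<circ> p"

definition simple_mf :: "(ennreal, 's::abstract_sigma_algebra) mfun \<Rightarrow> bool"
  where "simple_mf f \<longleftrightarrow> (\<exists>n p s. simple_factorization f n p s)"

definition simple_integral ::
  "('s::abstract_sigma_algebra \<Rightarrow> ennreal) \<Rightarrow> (ennreal, 's) mfun \<Rightarrow> ennreal"
  where "simple_integral \<mu> f = (THE r. \<exists>n p s x. simple_factorization f n p s \<and>
    (\<forall>U. open U \<longrightarrow> p (open_elem U) = {i \<in> {..n}. x i \<in> U}) \<and>
    r = (\<Sum>i\<le>n. \<mu> (s {i}) * x i))"

definition mf_integral ::
  "('s::abstract_sigma_algebra \<Rightarrow> ennreal) \<Rightarrow> (ennreal, 's) mfun \<Rightarrow> ennreal"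
  where "mf_integral \<mu> f = Sup {simple_integral \<mu> g | g. mf_le g f \<and> simple_mf g}"

definition mf_integrable ::
  "('s::abstract_sigma_algebra \<Rightarrow> ennreal) \<Rightarrow> (ennreal, 's) mfun \<Rightarrow> bool"
  where "mf_integrable \<mu> f \<longleftrightarrow> mf_integral \<mu> f < \<infinity>"

definition complex_mf_integrable ::
  "('s::abstract_sigma_algebra \<Rightarrow> ennreal) \<Rightarrow> (complex, 's) mfun \<Rightarrow> bool"
  where "complex_mf_integrable \<mu> f \<longleftrightarrow> mf_integrable \<mu> (mf_abs f)"

text \<open>
  The next two definitions are only meaningful for integrable functions, whose positive and
  negative parts have finite integrals, so that \<^const>\<open>enn2real\<close> is the inclusion.
\<close>

definition real_mf_integral ::
  "('s::abstract_sigma_algebra \<Rightarrow> ennreal) \<Rightarrow> (real, 's) mfun \<Rightarrow> real"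
  where "real_mf_integral \<mu> u =
    enn2real (mf_integral \<mu> (mf_pos u)) - enn2real (mf_integral \<mu> (mf_neg u))"

definition complex_mf_integral ::
  "('s::abstract_sigma_algebra \<Rightarrow> ennreal) \<Rightarrow> (complex, 's) mfun \<Rightarrow> complex"
  where "complex_mf_integral \<mu> f =
    Complex (real_mf_integral \<mu> (mf_unary Re f)) (real_mf_integral \<mu> (mf_unary Im f))"

end

theory Submission
  imports Defs
begin

text \<open>
  The theorem is reduced to the classical dominated convergence theorem on a space of points.

  By the Loomis--Sikorski theorem, shown below as \<open>loomis_sikorski\<close>, the abstract sigma-algebra is
  the image of a sigma-algebra of sets under a morphism \<open>\<Phi>\<close>. The points are the sets of elements of
  the algebra, and the set \<open>{\<omega>. a \<in> \<omega>}\<close> is sent to \<open>a\<close>. Such a morphism exists because no countable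
  Boolean expression with nonzero value in the algebra becomes empty when it is evaluated in
  points: only countably many joins occur in it, and there is a filter that contains
  the value and meets these joins (\<open>generic_filter_exists\<close>). The measure \<open>\<mu>\<close> is pulled back to
  \<open>A \<mapsto> \<mu> (\<Phi> A)\<close>, so that the sets with \<open>\<Phi> A = bot\<close> are null.

  A measurable function \<open>h\<close> in the sense of morphisms then has an ordinary measurable function \<open>u\<close> as
  a representative, with \<open>h U = \<Phi> (u -` U)\<close> for all open \<open>U\<close>. For values in \<open>[0, \<infinity>]\<close> it is put
  together from its superlevel sets (\<open>ennreal_mfun_represented\<close>), and real and complex functions
  are reduced to this case. On representatives, continuous operations and countable
  suprema and infima are pointwise (\<open>represents_binary\<close>, \<open>represents_limsup\<close>), the order is the
  order almost everywhere (\<open>mf_le_AE\<close>), convergence implies convergence almost everywhere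
  (\<open>mf_tendsto_AE\<close>), and the integral is the Lebesgue integral (\<open>mf_integral_eq_nn_integral\<close>).
  The last point uses that \<open>\<Phi>\<close> is onto, so that every simple function of the algebra has a
  representative.
\<close>


section \<open>Filters that meet countably many joins\<close>

lemma SUP_upper_nat: "x i \<le> (SUP i. x i)" for x :: "nat \<Rightarrow> 's::abstract_sigma_algebra"
  by (rule ccSUP_upper) simp_all

text \<open>
  The members of \<open>J\<close> are sequences, and each stands for the join of its terms. A filter that
  is generic for \<open>J\<close> treats these joins as a point of a space treats unions of sets.
\<close>

definition generic_filter :: "(nat \<Rightarrow> 's) set \<Rightarrow> 's::abstract_sigma_algebra set \<Rightarrow> bool"
  where "generic_filter J \<omega> \<longleftrightarrow> bot \<notin> \<omega> \<and> top \<in> \<omega> \<and>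
    (\<forall>a\<in>\<omega>. \<forall>b. a \<le> b \<longrightarrow> b \<in> \<omega>) \<and> (\<forall>a\<in>\<omega>. \<forall>b\<in>\<omega>. inf a b \<in> \<omega>) \<and>
    (\<forall>x\<in>J. (SUP i. x i) \<in> \<omega> \<longrightarrow> (\<exists>i. x i \<in> \<omega>))"

text \<open>
  This is the Rasiowa--Sikorski lemma. Enumerate \<open>J\<close> and decrease \<open>a\<close> step by step, keeping it
  nonzero: if the current element meets the join of the next sequence then, since finite meets
  distribute over countable joins, it already meets some term, and the intersection with that
  term is the next element. The elements above some member of the decreasing sequence form the
  filter.
\<close>

lemma generic_filter_exists:
  fixes a :: "'s::abstract_sigma_algebra"
  assumes "countable J" and "a \<noteq> bot"
  shows "\<exists>\<omega>. generic_filter J \<omega> \<and> a \<in> \<omega>"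
proof -
  \<comment> \<open>A join that the current element misses stays outside the filter and needs no action.\<close>
  define c where "c = rec_nat a (\<lambda>k c. if inf c (SUP i. from_nat_into J k i) = bot then c
    else inf c (from_nat_into J k (SOME i. inf c (from_nat_into J k i) \<noteq> bot)))"
  have c_0: "c 0 = a" by (simp add: c_def)
  have c_Suc: "c (Suc k) = (if inf (c k) (SUP i. from_nat_into J k i) = bot then c k
    else inf (c k) (from_nat_into J k (SOME i. inf (c k) (from_nat_into J k i) \<noteq> bot)))" for k
    by (simp add: c_def)
  have ex: "\<exists>i. inf b (x i) \<noteq> bot" if "inf b (SUP i. x i) \<noteq> bot" for b :: 's and x :: "nat \<Rightarrow> 's"
  proof (rule ccontr)
    assume "\<nexists>i. inf b (x i) \<noteq> bot"
    then have "(SUP i. inf b (x i)) = bot" by simp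
    with inf_SUP_le[of b x] that show False by (simp add: bot_unique)
  qed
  have nonzero: "c k \<noteq> bot" for k
  proof (induction k)
    case (Suc k)
    show ?case
    proof (cases "inf (c k) (SUP i. from_nat_into J k i) = bot")
      case False
      from someI_ex[OF ex[OF this]] False show ?thesis by (simp add: c_Suc)
    qed (use Suc in \<open>simp add: c_Suc\<close>)
  qed (simp add: c_0 assms)
  have "c (Suc k) \<le> c k" for k by (simp add: c_Suc)
  then have anti: "c n \<le> c m" if "m \<le> n" for m n
    using that by (rule lift_Suc_antimono_le)
  define \<omega> where "\<omega> = {b. \<exists>k. c k \<le> b}"
  have "generic_filter J \<omega>"
    unfolding generic_filter_def
  proof (intro conjI ballI allI impI)
    show "bot \<notin> \<omega>" using nonzero by (auto simp: \<omega>_def bot_unique)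
    show "top \<in> \<omega>" by (simp add: \<omega>_def)
    show "d \<in> \<omega>" if "b \<in> \<omega>" "b \<le> d" for b d
    proof -
      from that obtain k where "c k \<le> b" by (auto simp: \<omega>_def)
      with that(2) show ?thesis unfolding \<omega>_def by (blast intro: order.trans)
    qed
    show "inf b d \<in> \<omega>" if "b \<in> \<omega>" "d \<in> \<omega>" for b d
    proof -
      from that obtain k m where km: "c k \<le> b" "c m \<le> d" by (auto simp: \<omega>_def)
      have "c (max k m) \<le> inf b d"
        using order.trans[OF anti[of k "max k m"] km(1)] order.trans[OF anti[of m "max k m"] km(2)] by simp
      then show ?thesis by (auto simp: \<omega>_def)
    qed
    show "\<exists>i. x i \<in> \<omega>" if x: "x \<in> J" "(SUP i. x i) \<in> \<omega>" for x
    proof -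
      obtain k where k: "from_nat_into J k = x"
        using from_nat_into_surj[OF assms(1) x(1)] by blast
      from x(2) obtain m where m: "c m \<le> (SUP i. x i)" by (auto simp: \<omega>_def)
      have "inf (c k) (SUP i. x i) \<noteq> bot"
      proof
        assume "inf (c k) (SUP i. x i) = bot"
        moreover have "c (max k m) \<le> inf (c k) (SUP i. x i)"
          using anti[of k "max k m"] order.trans[OF anti[of m "max k m"] m] by simp
        ultimately show False using nonzero[of "max k m"] by (simp add: bot_unique)
      qed
      then have "c (Suc k) \<le> x (SOME i. inf (c k) (x i) \<noteq> bot)" by (simp add: c_Suc k)
      then show ?thesis by (auto simp: \<omega>_def)
    qed
  qed
  moreover have "a \<in> \<omega>" using c_0 by (auto simp: \<omega>_def intro!: exI[of _ 0])
  ultimately show ?thesis by blast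
qed


section \<open>The Loomis--Sikorski representation\<close>

text \<open>
  \<open>realizes A a\<close> says that \<open>A\<close> and \<open>a\<close> are the values of one countable Boolean expression in
  the generators \<open>b\<close>, evaluated with \<open>{\<omega>. b \<in> \<omega>}\<close> for \<open>b\<close> and in the algebra itself.
\<close>

inductive realizes :: "'s::abstract_sigma_algebra set set \<Rightarrow> 's \<Rightarrow> bool" where
  gen: "realizes {\<omega>. a \<in> \<omega>} a"
| compl: "realizes A a \<Longrightarrow> realizes (- A) (- a)"
| union: "(\<And>i::nat. realizes (A i) (a i)) \<Longrightarrow> realizes (\<Union>i. A i) (SUP i. a i)"

text \<open>
  An expression contains only countably many joins. For a filter that is generic for all of them,
  evaluation in points and evaluation in the algebra agree, by induction on the expression.
\<close>

lemma realizes_generic: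
  "realizes A a \<Longrightarrow> \<exists>J. countable J \<and> (\<forall>\<omega>. generic_filter J \<omega> \<longrightarrow> (\<omega> \<in> A \<longleftrightarrow> a \<in> \<omega>))"
proof (induction rule: realizes.induct)
  case (gen a)
  then show ?case by (auto intro!: exI[of _ "{}"])
next
  case (compl A a)
  then obtain J where J: "countable J" "\<And>\<omega>. generic_filter J \<omega> \<Longrightarrow> \<omega> \<in> A \<longleftrightarrow> a \<in> \<omega>" by blast
  \<comment> \<open>A filter that meets this join, whose value is \<open>top\<close>, contains \<open>a\<close> or its complement.\<close>
  define x where "x = (\<lambda>i::nat. if i = 0 then a else - a)"
  have "(SUP i. x i) = sup a (- a)" unfolding x_def sup_eq_SUP_nat ..
  then have x: "(SUP i. x i) = top" by simp
  have "\<omega> \<in> - A \<longleftrightarrow> - a \<in> \<omega>" if *: "generic_filter (insert x J) \<omega>" for \<omega>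
  proof -
    from * have "generic_filter J \<omega>" by (simp add: generic_filter_def)
    moreover from * x have "\<exists>i. x i \<in> \<omega>" by (simp add: generic_filter_def)
    then have "a \<in> \<omega> \<or> - a \<in> \<omega>" by (metis x_def)
    moreover have "\<not> (a \<in> \<omega> \<and> - a \<in> \<omega>)"
    proof
      assume "a \<in> \<omega> \<and> - a \<in> \<omega>"
      with * have "inf a (- a) \<in> \<omega>" unfolding generic_filter_def by blast
      with * show False by (simp add: generic_filter_def)
    qed
    ultimately show ?thesis using J(2) by blast
  qed
  with J(1) show ?case by (intro exI[of _ "insert x J"]) simp
next
  case (union A a)
  then obtain J where J: "\<And>i. countable (J i)"
    "\<And>i \<omega>. generic_filter (J i) \<omega> \<Longrightarrow> \<omega> \<in> A i \<longleftrightarrow> a i \<in> \<omega>" by metis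
  have "\<omega> \<in> (\<Union>i. A i) \<longleftrightarrow> (SUP i. a i) \<in> \<omega>" if *: "generic_filter (insert a (\<Union>i. J i)) \<omega>" for \<omega>
  proof -
    from * have "generic_filter (J i) \<omega>" for i by (auto simp: generic_filter_def)
    then have "\<omega> \<in> (\<Union>i. A i) \<longleftrightarrow> (\<exists>i. a i \<in> \<omega>)" using J(2) by blast
    also have "\<dots> \<longleftrightarrow> (SUP i. a i) \<in> \<omega>"
    proof
      assume "\<exists>i. a i \<in> \<omega>"
      then obtain i where "a i \<in> \<omega>" ..
      with * SUP_upper_nat[of a i] show "(SUP i. a i) \<in> \<omega>" unfolding generic_filter_def by blast
    qed (use * in \<open>simp add: generic_filter_def\<close>)
    finally show ?thesis .
  qed
  with J(1) show ?case by (intro exI[of _ "insert a (\<Union>i. J i)"]) simp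
qed

text \<open>
  A nonzero \<open>a\<close> would lie in a filter that is generic for the joins of the expression, and that
  filter would be an element of the empty set.
\<close>

lemma realizes_empty:
  assumes "realizes {} a" shows "a = bot"
proof (rule ccontr)
  assume "a \<noteq> bot"
  from realizes_generic[OF assms] obtain J where "countable J" "\<And>\<omega>. generic_filter J \<omega> \<Longrightarrow> a \<notin> \<omega>" by blast
  with generic_filter_exists[OF this(1) \<open>a \<noteq> bot\<close>] show False by blast
qed

lemma realizes_Un:
  assumes "realizes A a" "realizes B b"
  shows "realizes (A \<union> B) (sup a b)"
proof -
  have "realizes (\<Union>i::nat. if i = 0 then A else B) (SUP i::nat. if i = 0 then a else b)"
    by (rule realizes.union) (simp add: assms)
  moreover have "(\<Union>i::nat. if i = 0 then A else B) = A \<union> B" by (auto split: if_splits)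
  ultimately show ?thesis unfolding sup_eq_SUP_nat[of a b] by metis
qed

lemma realizes_mono:
  assumes "realizes A a" "realizes B b" "A \<subseteq> B"
  shows "a \<le> b"
proof -
  have "realizes (- (- A \<union> B)) (- sup (- a) b)"
    by (intro realizes.compl realizes_Un assms)
  moreover have "- (- A \<union> B) = {}" using assms(3) by auto
  ultimately have "- sup (- a) b = bot" by (metis realizes_empty)
  then have "inf a (- b) = bot" by (simp add: compl_sup)
  then show ?thesis by (metis double_compl inf.commute inf_shunt)
qed

text \<open>
  This presents an abstract sigma-algebra as a quotient of a sigma-algebra of sets: the sets that
  \<open>\<Phi>\<close> sends to \<open>bot\<close> are the negligible ones, and every element of the algebra lifts to a set.
\<close>

locale set_representation =
  fixes M :: "'w measure" and \<Phi> :: "'w set \<Rightarrow> 's::abstract_sigma_algebra"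
  assumes space_M [simp]: "space M = UNIV"
    and Phi_Compl: "\<And>A. A \<in> sets M \<Longrightarrow> \<Phi> (- A) = - \<Phi> A"
    and Phi_UN_nat: "\<And>A. (\<And>i::nat. A i \<in> sets M) \<Longrightarrow> \<Phi> (\<Union>i. A i) = (SUP i. \<Phi> (A i))"
    and Phi_surj: "\<And>a. \<exists>A\<in>sets M. \<Phi> A = a"

text \<open>
  Here \<open>M\<close> carries the measure pulled back along \<open>\<Phi>\<close>, so that sets with image \<open>bot\<close> are null.
\<close>

locale measured_representation = set_representation M \<Phi>
  for M :: "'w measure" and \<Phi> :: "'w set \<Rightarrow> 's::abstract_sigma_algebra" +
  fixes \<mu> :: "'s \<Rightarrow> ennreal"
  assumes mu: "is_measure \<mu>"
    and emeasure_M: "\<And>A. A \<in> sets M \<Longrightarrow> emeasure M A = \<mu> (\<Phi> A)"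

text \<open>
  The set that realizes an element is not unique, but the element realized by a set is:
  if \<open>A\<close> realizes \<open>a\<close> and \<open>b\<close>, then the empty set, being the difference of \<open>A\<close> and \<open>A\<close>, realizes
  \<open>a - b\<close>, which therefore vanishes. So the relation is the graph of a map \<open>\<Phi>\<close>, and it is a
  morphism by the very form of \<^const>\<open>realizes\<close>. It is onto because every element is a generator.
\<close>

theorem loomis_sikorski:
  fixes \<mu> :: "'s::abstract_sigma_algebra \<Rightarrow> ennreal"
  assumes "is_measure \<mu>"
  shows "\<exists>(M :: 's set measure) \<Phi>. measured_representation M \<Phi> \<mu>"
proof -
  define S where "S = {A. \<exists>a::'s. realizes A a}"
  define \<Phi> where "\<Phi> A = (THE a::'s. realizes A a)" for A
  have Phi_eq: "\<Phi> A = a" if "realizes A a" for A a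
  proof -
    have eq: "b = a" if "realizes A b" for b
      using realizes_mono[OF that \<open>realizes A a\<close>] realizes_mono[OF \<open>realizes A a\<close> that]
      by (simp add: order.antisym)
    show ?thesis unfolding \<Phi>_def using that eq by (rule the_equality)
  qed
  have S: "A \<in> S \<and> \<Phi> A = a" if "realizes A a" for A a
    unfolding S_def using that Phi_eq[OF that] by blast
  have Phi: "realizes A (\<Phi> A)" if A: "A \<in> S" for A
  proof -
    from A obtain a where "realizes A a" unfolding S_def by blast
    with Phi_eq[OF this] show ?thesis by simp
  qed
  have compl: "- A \<in> S \<and> \<Phi> (- A) = - \<Phi> A" if "A \<in> S" for A
    by (rule S, rule realizes.compl, rule Phi, rule that)
  have UN: "(\<Union>i. A i) \<in> S \<and> \<Phi> (\<Union>i. A i) = (SUP i. \<Phi> (A i))" if "\<And>i. A i \<in> S" for A :: "nat \<Rightarrow> _"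
    by (rule S, rule realizes.union, rule Phi, rule that)
  have gen: "\<exists>A\<in>S. \<Phi> A = a" for a
    using S[OF realizes.gen[of a]] by blast
  have un: "A \<union> B \<in> S \<and> \<Phi> (A \<union> B) = sup (\<Phi> A) (\<Phi> B)" if "A \<in> S" "B \<in> S" for A B
    by (intro S realizes_Un Phi that)
  obtain A where A: "A \<in> S" using gen by blast
  have UNIV: "UNIV \<in> S" using un[OF A compl[THEN conjunct1, OF A]] by simp
  have empty: "{} \<in> S" using compl[OF UNIV] by simp
  have Phi_empty: "\<Phi> {} = bot" using realizes_empty[OF Phi[OF empty]] .
  have sa: "sigma_algebra UNIV S"
    unfolding sigma_algebra_iff2
    using empty compl UN[THEN conjunct1] by (auto simp: Compl_eq_Diff_UNIV[symmetric] image_subset_iff)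
  define M where "M = measure_of UNIV S (\<lambda>A. \<mu> (\<Phi> A))"
  have sets: "sets M = S" and space: "space M = UNIV"
    unfolding M_def by (rule sigma_algebra.sets_measure_of_eq[OF sa], rule sigma_algebra.space_measure_of_eq[OF sa])
  have disj: "inf (\<Phi> A) (\<Phi> B) = bot" if "A \<in> S" "B \<in> S" "A \<inter> B = {}" for A B
  proof -
    have "\<Phi> A \<le> \<Phi> (- B)"
      by (rule realizes_mono[OF Phi[OF that(1)] Phi[OF compl[THEN conjunct1, OF that(2)]]])
        (use that(3) in auto)
    with compl that(2) show ?thesis by (simp add: inf_shunt)
  qed
  have "measure_space UNIV S (\<lambda>A. \<mu> (\<Phi> A))"
    unfolding measure_space_def
  proof (intro conjI)
    show "positive S (\<lambda>A. \<mu> (\<Phi> A))"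
      using assms by (simp add: positive_def Phi_empty is_measure_def)
    show "countably_additive S (\<lambda>A. \<mu> (\<Phi> A))"
      unfolding countably_additive_def
    proof (intro allI impI)
      fix A :: "nat \<Rightarrow> 's set set"
      assume A: "range A \<subseteq> S" "disjoint_family A"
      then have A_in: "A i \<in> S" for i by blast
      have "inf (\<Phi> (A i)) (\<Phi> (A j)) = bot" if "i \<noteq> j" for i j
        using A(2) that by (intro disj A_in) (auto simp: disjoint_family_on_def)
      then have "\<mu> (SUP i. \<Phi> (A i)) = (\<Sum>i. \<mu> (\<Phi> (A i)))"
        by (intro assms[unfolded is_measure_def, THEN conjunct2, rule_format])
      then show "(\<Sum>i. \<mu> (\<Phi> (A i))) = \<mu> (\<Phi> (\<Union> (range A)))"
        using UN[of A, OF A_in] by simp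
    qed
  qed (rule sa)
  then have "emeasure M A = \<mu> (\<Phi> A)" if "A \<in> S" for A
    using that unfolding M_def by (intro emeasure_measure_of_sigma) (auto simp: measure_space_def)
  then have "measured_representation M \<Phi> \<mu>"
    using compl UN gen assms by unfold_locales (auto simp: space sets)
  then show ?thesis by blast
qed


section \<open>Morphisms on the open sets of a space\<close>

lemma image_eq_range_from_nat_into:
  "countable I \<Longrightarrow> I \<noteq> {} \<Longrightarrow> f ` I = range (\<lambda>n. f (from_nat_into I n))"
  by (metis image_image range_from_nat_into)

lemma open_frame_morphism_Union:
  assumes "open_frame_morphism \<phi>" "countable K" "\<And>U. U \<in> K \<Longrightarrow> open U"
  shows "\<phi> (\<Union>K) = Sup (\<phi> ` K)"
proof (cases "K = {}")
  case True
  with assms(1) show ?thesis by (simp add: open_frame_morphism_def)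
next
  case False
  have "\<phi> (\<Union>n. from_nat_into K n) = (SUP n. \<phi> (from_nat_into K n))"
    using assms(1,3) from_nat_into[OF False] unfolding open_frame_morphism_def by blast
  then show ?thesis
    by (simp add: image_eq_range_from_nat_into[OF assms(2) False] range_from_nat_into[OF False assms(2)])
qed

lemma open_frame_morphism_UN:
  assumes "open_frame_morphism \<phi>" "countable I" "\<And>i. i \<in> I \<Longrightarrow> open (U i)"
  shows "\<phi> (\<Union>i\<in>I. U i) = (SUP i\<in>I. \<phi> (U i))"
  using open_frame_morphism_Union[OF assms(1), of "U ` I"] assms(2,3) by (auto simp: image_image)

lemma open_frame_morphism_Un:
  assumes "open_frame_morphism \<phi>" "open U" "open V"
  shows "\<phi> (U \<union> V) = sup (\<phi> U) (\<phi> V)"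
  using open_frame_morphism_Union[OF assms(1), of "{U, V}"] assms(2,3) by (auto simp: ccSup_insert)

lemma open_frame_morphism_cong:
  assumes "open_frame_morphism \<psi>" "\<And>U. open U \<Longrightarrow> \<phi> U = \<psi> U"
  shows "open_frame_morphism \<phi>"
  using assms(1) by (simp add: open_frame_morphism_def assms(2) open_Int open_UN)

lemma open_frame_morphism_of_sigma_morphism:
  "sigma_morphism h \<Longrightarrow> open_frame_morphism (\<lambda>U. h (open_elem U))"
  using open_frame_morphism_unary[of h "\<lambda>x. x"] by (simp add: vimage_def)

lemma sigma_morphism_eqI:
  assumes "sigma_morphism h" "sigma_morphism h'"
    and "\<And>U. open U \<Longrightarrow> h (open_elem U) = h' (open_elem U)"
  shows "h = h'"
proof -
  let ?P = "\<lambda>F. sigma_morphism F \<and> (\<forall>U. open U \<longrightarrow> F (open_elem U) = h (open_elem U))"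
  have ex1: "Ex1 ?P" by (rule universal_property[OF open_frame_morphism_of_sigma_morphism[OF assms(1)]])
  have "The ?P = h" by (rule the1_equality[OF ex1]) (simp add: assms(1))
  moreover have "The ?P = h'" by (rule the1_equality[OF ex1]) (simp add: assms(2,3))
  ultimately show ?thesis by simp
qed

text \<open>
  A second countable space is Lindelof, so that an arbitrary union of open sets is a countable one
  and a morphism of sigma-frames is determined by its values on any subbase.
\<close>

lemma open_frame_morphism_agree:
  fixes \<phi> \<psi> :: "'y::second_countable_topology set \<Rightarrow> 's::abstract_sigma_algebra"
  assumes "open_frame_morphism \<phi>" "open_frame_morphism \<psi>"
    and "\<And>U. U \<in> G \<Longrightarrow> open U" "\<And>U. U \<in> G \<Longrightarrow> \<phi> U = \<psi> U"
    and "generate_topology G U"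
  shows "\<phi> U = \<psi> U"
proof -
  from assms(5) have "open U \<and> \<phi> U = \<psi> U"
  proof (induction rule: generate_topology.induct)
    case UNIV
    show ?case using assms(1,2) by (simp add: open_frame_morphism_def)
  next
    case (Int A B)
    then show ?case using assms(1,2) by (simp add: open_frame_morphism_def open_Int)
  next
    case (UN K)
    then have K: "\<And>U. U \<in> K \<Longrightarrow> open U" by blast
    obtain K' where K': "K' \<subseteq> K" "countable K'" "\<Union>K' = \<Union>K"
      using Lindelof[of K] K by metis
    have "U \<in> K' \<Longrightarrow> open U" for U using K K'(1) by blast
    from open_frame_morphism_Union[OF assms(1) K'(2) this] open_frame_morphism_Union[OF assms(2) K'(2) this]
    have "\<phi> (\<Union>K) = Sup (\<phi> ` K')" "\<psi> (\<Union>K) = Sup (\<psi> ` K')"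
      unfolding K'(3) by blast+
    moreover have "\<phi> ` K' = \<psi> ` K'"
    proof (rule image_cong)
      fix U assume "U \<in> K'"
      with K'(1) UN.IH show "\<phi> U = \<psi> U" by blast
    qed simp
    ultimately show ?case using K by (simp add: open_Union)
  next
    case (Basis U)
    then show ?case using assms(3,4) by simp
  qed
  then show ?thesis ..
qed

text \<open>
  In the algebra a closed set is the complement of an open one. If \<open>T\<close> is exhausted by open sets
  each of which is separated from the complement of \<open>T\<close> by an open set \<open>U q\<close>, then \<open>T\<close> is the join
  of the closed sets \<open>- U q\<close>, so that its value is determined by the values on the \<open>U q\<close>.
\<close>

lemma open_frame_morphism_complement:
  assumes \<phi>: "open_frame_morphism \<phi>" and Q: "countable Q"
    and "open T" "\<And>q. q \<in> Q \<Longrightarrow> open (U q)" "\<And>q. q \<in> Q \<Longrightarrow> open (V q)"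
    and T: "T = (\<Union>q\<in>Q. V q)" and "\<And>q. q \<in> Q \<Longrightarrow> V q \<inter> U q = {}" "\<And>q. q \<in> Q \<Longrightarrow> T \<union> U q = UNIV"
  shows "\<phi> T = (SUP q\<in>Q. - \<phi> (U q))"
proof (rule order.antisym)
  have "\<phi> T = (SUP q\<in>Q. \<phi> (V q))"
    using open_frame_morphism_UN[OF \<phi> Q] assms(5) T by simp
  also have "\<dots> \<le> (SUP q\<in>Q. - \<phi> (U q))"
  proof (rule ccSUP_mono[OF Q Q])
    fix q assume q: "q \<in> Q"
    have "inf (\<phi> (V q)) (\<phi> (U q)) = \<phi> (V q \<inter> U q)"
      using \<phi> q assms(4,5) by (simp add: open_frame_morphism_def)
    also have "\<dots> = bot" using \<phi> q assms(7) by (simp add: open_frame_morphism_def)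
    finally show "\<exists>q'\<in>Q. \<phi> (V q) \<le> - \<phi> (U q')" using q by (auto simp: inf_shunt)
  qed
  finally show "\<phi> T \<le> (SUP q\<in>Q. - \<phi> (U q))" .
  show "(SUP q\<in>Q. - \<phi> (U q)) \<le> \<phi> T"
  proof (rule ccSUP_least)
    fix q assume q: "q \<in> Q"
    have "sup (\<phi> T) (\<phi> (U q)) = \<phi> (T \<union> U q)"
      using open_frame_morphism_Un[OF \<phi>] assms(3,4) q by simp
    also have "\<dots> = top" using \<phi> q assms(8) by (simp add: open_frame_morphism_def)
    finally show "- \<phi> (U q) \<le> \<phi> T" by (simp add: sup_shunt[symmetric] sup.commute)
  qed (simp add: Q)
qed

lemma ennreal_frame_morphism_rays:
  fixes \<phi> :: "ennreal set \<Rightarrow> 's::abstract_sigma_algebra"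
  assumes \<phi>: "open_frame_morphism \<phi>"
    and D: "countable D" "\<And>x y. x < y \<Longrightarrow> \<exists>q\<in>D. x < q \<and> q < (y::ennreal)"
  shows "\<phi> {..<t} = (SUP q\<in>D \<inter> {..<t}. - \<phi> {q<..})"
    and "\<phi> {t<..} = (SUP q\<in>D \<inter> {t<..}. - \<phi> {..<q})"
proof -
  have "x < t \<longleftrightarrow> (\<exists>q\<in>D \<inter> {..<t}. x < q)" "t < x \<longleftrightarrow> (\<exists>q\<in>D \<inter> {t<..}. q < x)" for x
    using D(2)[of x t] D(2)[of t x] by (auto intro: less_trans)
  then have T: "{..<t} = (\<Union>q\<in>D \<inter> {..<t}. {..<q})" "{t<..} = (\<Union>q\<in>D \<inter> {t<..}. {q<..})"
    by blast+
  have cover: "{..<t} \<union> {q<..} = UNIV" if "q < t" for q t :: ennreal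
    using that by (auto intro: le_less_trans simp: not_less)
  show "\<phi> {..<t} = (SUP q\<in>D \<inter> {..<t}. - \<phi> {q<..})"
  proof (rule open_frame_morphism_complement[where U = greaterThan and V = lessThan, OF \<phi> _ _ _ _ T(1)])
    show "countable (D \<inter> {..<t})" using D(1) by simp
    show "{..<t} \<union> {q<..} = UNIV" if "q \<in> D \<inter> {..<t}" for q using that cover by simp
  qed auto
  show "\<phi> {t<..} = (SUP q\<in>D \<inter> {t<..}. - \<phi> {..<q})"
  proof (rule open_frame_morphism_complement[where U = lessThan and V = greaterThan, OF \<phi> _ _ _ _ T(2)])
    show "countable (D \<inter> {t<..})" using D(1) by simp
    show "{t<..} \<union> {..<q} = UNIV" if "q \<in> D \<inter> {t<..}" for q using that cover[of t q] by auto
  qed auto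
qed

lemma ennreal_countable_dense:
  "\<exists>D::ennreal set. countable D \<and> (\<forall>x y. x < y \<longrightarrow> (\<exists>q\<in>D. x < q \<and> q < y))"
proof -
  obtain D :: "ennreal set" where D: "countable D" "\<And>X. open X \<Longrightarrow> X \<noteq> {} \<Longrightarrow> \<exists>d\<in>D. d \<in> X"
    by (rule countable_dense_setE) blast
  have "\<exists>q\<in>D. x < q \<and> q < y" if "x < y" for x y
    using D(2)[of "{x<..<y}"] dense[OF that] by auto
  with D(1) show ?thesis by blast
qed

text \<open>
  By the previous formulas the rays of one direction determine the rays of the other direction,
  and all rays together form a subbase.
\<close>

lemma ennreal_frame_morphism_agree:
  fixes \<phi> \<psi> :: "ennreal set \<Rightarrow> 's::abstract_sigma_algebra"
  assumes "open_frame_morphism \<phi>" "open_frame_morphism \<psi>"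
    and "(\<forall>t. \<phi> {t<..} = \<psi> {t<..}) \<or> (\<forall>t. \<phi> {..<t} = \<psi> {..<t})"
    and "open U"
  shows "\<phi> U = \<psi> U"
proof -
  obtain D :: "ennreal set" where D: "countable D" "\<And>x y. x < y \<Longrightarrow> \<exists>q\<in>D. x < q \<and> q < y"
    using ennreal_countable_dense by blast
  note \<phi> = ennreal_frame_morphism_rays[OF assms(1) D] and \<psi> = ennreal_frame_morphism_rays[OF assms(2) D]
  have agree: "\<phi> {t<..} = \<psi> {t<..} \<and> \<phi> {..<t} = \<psi> {..<t}" for t
  proof (cases "\<forall>t. \<phi> {t<..} = \<psi> {t<..}")
    case True
    then show ?thesis by (simp add: \<phi>(1)[of t] \<psi>(1)[of t])
  next
    case False
    with assms(3) have "\<forall>t. \<phi> {..<t} = \<psi> {..<t}" by blast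
    then show ?thesis by (simp add: \<phi>(2)[of t] \<psi>(2)[of t])
  qed
  have "generate_topology (range lessThan \<union> range greaterThan) U"
    using assms(4) unfolding open_generated_order by simp
  moreover have "\<And>V. V \<in> range lessThan \<union> range greaterThan \<Longrightarrow> \<phi> V = \<psi> V"
    using agree by blast
  moreover have "\<And>V::ennreal set. V \<in> range lessThan \<union> range greaterThan \<Longrightarrow> open V" by auto
  ultimately show ?thesis
    using open_frame_morphism_agree[OF assms(1,2)] by blast
qed

lemma ennreal_mfun_eqI:
  fixes G G' :: "(ennreal, 's::abstract_sigma_algebra) mfun"
  assumes "sigma_morphism G" "sigma_morphism G'"
    and "(\<forall>t. G (lower_elem t) = G' (lower_elem t)) \<or> (\<forall>t. G (upper_elem t) = G' (upper_elem t))"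
  shows "G = G'"
proof (rule sigma_morphism_eqI[OF assms(1,2)])
  have compl: "G (- a) = - G a" "G' (- a) = - G' a" for a
    using assms(1,2) unfolding sigma_morphism_iff by blast+
  have "(\<forall>t. G (open_elem {t<..}) = G' (open_elem {t<..})) \<or> (\<forall>t. G (open_elem {..<t}) = G' (open_elem {..<t}))"
    using assms(3) by (simp add: lower_elem_def upper_elem_def compl)
  then show "G (open_elem U) = G' (open_elem U)" if "open U" for U
    using that ennreal_frame_morphism_agree[OF assms(1,2)[THEN open_frame_morphism_of_sigma_morphism]]
    by blast
qed


section \<open>Representation of measurable functions by functions on points\<close>

context set_representation
begin

lemma Phi_Un:
  assumes "A \<in> sets M" "B \<in> sets M" shows "\<Phi> (A \<union> B) = sup (\<Phi> A) (\<Phi> B)"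
proof -
  have "A \<union> B = (\<Union>i::nat. if i = 0 then A else B)" by (auto split: if_splits)
  also have "\<Phi> \<dots> = (SUP i::nat. \<Phi> (if i = 0 then A else B))"
    by (rule Phi_UN_nat) (simp add: assms)
  also have "\<dots> = sup (\<Phi> A) (\<Phi> B)"
    unfolding sup_eq_SUP_nat[of "\<Phi> A" "\<Phi> B"] by (simp only: if_distrib[of \<Phi>])
  finally show ?thesis .
qed

lemma sets_Compl [simp, intro]: "A \<in> sets M \<Longrightarrow> - A \<in> sets M"
  using sets.compl_sets[of A M] by (simp add: Compl_eq_Diff_UNIV)

lemma Phi_UNIV [simp]: "\<Phi> UNIV = top"
proof -
  obtain A where "A \<in> sets M" using Phi_surj by blast
  then show ?thesis using Phi_Un[of A "- A"] Phi_Compl[of A] by simp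
qed

lemma sets_UNIV [simp, intro]: "UNIV \<in> sets M"
  using sets.top[of M] by simp

lemma Phi_empty [simp]: "\<Phi> {} = bot"
  using Phi_Compl[of UNIV] by simp

lemma Phi_Int:
  assumes "A \<in> sets M" "B \<in> sets M" shows "\<Phi> (A \<inter> B) = inf (\<Phi> A) (\<Phi> B)"
proof -
  have "\<Phi> (A \<inter> B) = \<Phi> (- (- A \<union> - B))" by simp
  also have "\<dots> = inf (\<Phi> A) (\<Phi> B)" using assms by (subst Phi_Compl) (auto simp: Phi_Un Phi_Compl)
  finally show ?thesis .
qed

lemma Phi_mono: "A \<in> sets M \<Longrightarrow> B \<in> sets M \<Longrightarrow> A \<subseteq> B \<Longrightarrow> \<Phi> A \<le> \<Phi> B"
  using Phi_Int[of A B] by (simp add: Int_absorb2 le_iff_inf)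

lemma Phi_UN:
  assumes "countable I" "\<And>i. i \<in> I \<Longrightarrow> A i \<in> sets M"
  shows "\<Phi> (\<Union>i\<in>I. A i) = (SUP i\<in>I. \<Phi> (A i))"
proof (cases "I = {}")
  case False
  have "\<Phi> (\<Union>n. A (from_nat_into I n)) = (SUP n. \<Phi> (A (from_nat_into I n)))"
    by (rule Phi_UN_nat) (simp add: assms(2) from_nat_into[OF False])
  then show ?thesis
    by (simp add: image_eq_range_from_nat_into[OF assms(1) False])
qed simp

text \<open>
  Preimages count only through their images under \<open>\<Phi>\<close>. Functions that differ on a set with image
  \<open>bot\<close> therefore represent the same \<open>h\<close>.
\<close>

definition represents :: "('y::topological_space, 's) mfun \<Rightarrow> ('w \<Rightarrow> 'y) \<Rightarrow> bool"
  where "represents h u \<longleftrightarrow> sigma_morphism h \<and> u \<in> borel_measurable M \<and>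
    (\<forall>U. open U \<longrightarrow> h (open_elem U) = \<Phi> (u -` U))"

lemma vimage_sets: "u \<in> borel_measurable M \<Longrightarrow> B \<in> sets borel \<Longrightarrow> u -` B \<in> sets M"
  using measurable_sets[of u M borel B] by simp

lemma open_frame_morphism_vimage:
  fixes u :: "'w \<Rightarrow> 'y::topological_space"
  assumes "u \<in> borel_measurable M"
  shows "open_frame_morphism (\<lambda>U. \<Phi> (u -` U))"
  unfolding open_frame_morphism_def
  by (simp add: vimage_UN Phi_Int Phi_UN_nat vimage_sets[OF assms])

text \<open>
  Preimages under \<open>u\<close>, followed by \<open>\<Phi>\<close>, form a morphism of sigma-frames. Hence any \<open>\<phi>\<close> that
  has these values is one as well, and its extension to the universal algebra is represented
  by \<open>u\<close>. Every operation on measurable functions is seen to act pointwise in this way.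
\<close>

lemma represents_sigma_extension:
  assumes "u \<in> borel_measurable M" "\<And>U. open U \<Longrightarrow> \<phi> U = \<Phi> (u -` U)"
  shows "represents (sigma_extension \<phi>) u"
proof -
  have "open_frame_morphism \<phi>"
    using open_frame_morphism_cong[OF open_frame_morphism_vimage[OF assms(1)] assms(2)] .
  from sigma_extension[OF this] show ?thesis
    using assms by (simp add: represents_def)
qed

lemma represents_const: "represents (mf_const c) (\<lambda>_. c)"
  unfolding mf_const_def by (rule represents_sigma_extension) (auto simp: vimage_def)

lemma represents_unary:
  fixes k :: "'y::topological_space \<Rightarrow> 'z::topological_space"
  assumes "represents f u" "continuous_on UNIV k"
  shows "represents (mf_unary k f) (\<lambda>\<omega>. k (u \<omega>))"
  unfolding mf_unary_def
proof (rule represents_sigma_extension)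
  show "(\<lambda>\<omega>. k (u \<omega>)) \<in> borel_measurable M"
    using assms borel_measurable_continuous_on unfolding represents_def by blast
  fix U :: "'z set" assume "open U"
  with assms(2) have "open (k -` U)" by (rule open_vimage[rotated])
  with assms(1) show "f (open_elem (k -` U)) = \<Phi> ((\<lambda>\<omega>. k (u \<omega>)) -` U)"
    by (simp add: represents_def vimage_def)
qed

text \<open>
  The preimage of an open set under a continuous binary operation is the union of the basic
  rectangles inside it. As the base is countable, \<open>\<Phi>\<close> turns this union into the join that defines
  the operation on measurable functions.
\<close>

lemma represents_binary:
  fixes u v :: "'w \<Rightarrow> 'y::second_countable_topology" and k :: "'y \<Rightarrow> 'y \<Rightarrow> 'z::topological_space"
  assumes f: "represents f u" and g: "represents g v"
    and k: "continuous_on UNIV (\<lambda>p. k (fst p) (snd p))"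
  shows "represents (mf_binary k f g) (\<lambda>\<omega>. k (u \<omega>) (v \<omega>))"
proof -
  define B where "B = (SOME B::'y set set. countable B \<and> topological_basis B)"
  have "countable B \<and> topological_basis B"
    unfolding B_def by (rule someI_ex[OF ex_countable_basis])
  then have B: "countable B" "topological_basis B" by auto
  have u: "u \<in> borel_measurable M" and v: "v \<in> borel_measurable M"
    using f g by (auto simp: represents_def)
  show ?thesis
    unfolding mf_binary_def B_def[symmetric] Let_def
  proof (rule represents_sigma_extension)
    show "(\<lambda>\<omega>. k (u \<omega>) (v \<omega>)) \<in> borel_measurable M"
      by (rule borel_measurable_continuous_Pair[OF u v k])
    fix U :: "'z set" assume U: "open U"
    define R where "R = {p \<in> B \<times> B. \<forall>x\<in>fst p. \<forall>y\<in>snd p. k x y \<in> U}"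
    have R: "countable R" unfolding R_def using B(1) by (intro countable_subset[OF Collect_restrict]) auto
    have R_open: "open (fst p)" "open (snd p)" if "p \<in> R" for p
      using that topological_basis_open[OF B(2)] by (auto simp: R_def)
    have "(\<lambda>\<omega>. k (u \<omega>) (v \<omega>)) -` U = (\<Union>p\<in>R. u -` fst p \<inter> v -` snd p)" (is "?l = ?r")
    proof
      show "?r \<subseteq> ?l" by (auto simp: R_def)
      show "?l \<subseteq> ?r"
      proof
        fix \<omega> assume "\<omega> \<in> ?l"
        moreover have "open ((\<lambda>p. k (fst p) (snd p)) -` U)" using U k by (rule open_vimage)
        ultimately obtain V W where VW: "open V" "open W" "(u \<omega>, v \<omega>) \<in> V \<times> W"
          "V \<times> W \<subseteq> (\<lambda>p. k (fst p) (snd p)) -` U"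
          by (elim open_prod_elim) auto
        obtain V' where V': "V' \<in> B" "u \<omega> \<in> V'" "V' \<subseteq> V"
          using topological_basisE[OF B(2) VW(1)] VW(3) by blast
        obtain W' where W': "W' \<in> B" "v \<omega> \<in> W'" "W' \<subseteq> W"
          using topological_basisE[OF B(2) VW(2)] VW(3) by blast
        have "k a b \<in> U" if "a \<in> V'" "b \<in> W'" for a b
          using subsetD[OF VW(4), of "(a, b)"] that V'(3) W'(3) by auto
        with V'(1) W'(1) have "(V', W') \<in> R" by (simp add: R_def)
        moreover have "\<omega> \<in> u -` fst (V', W') \<inter> v -` snd (V', W')" using V'(2) W'(2) by simp
        ultimately show "\<omega> \<in> ?r" by blast
      qed
    qed
    moreover have meas: "u -` fst p \<in> sets M" "v -` snd p \<in> sets M" if "p \<in> R" for p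
      using R_open[OF that] by (simp_all add: vimage_sets[OF u] vimage_sets[OF v])
    moreover have "\<Phi> ?r = (SUP p\<in>R. \<Phi> (u -` fst p \<inter> v -` snd p))"
      using R by (rule Phi_UN) (simp add: meas sets.Int)
    ultimately have "\<Phi> ?l = (SUP p\<in>R. \<Phi> (u -` fst p \<inter> v -` snd p))" by simp
    moreover have "\<Phi> (u -` fst p \<inter> v -` snd p) = inf (f (open_elem (fst p))) (g (open_elem (snd p)))"
      if "p \<in> R" for p
      using f g R_open[OF that] meas[OF that] by (simp add: Phi_Int represents_def)
    then have "(SUP p\<in>R. \<Phi> (u -` fst p \<inter> v -` snd p)) =
        (SUP p\<in>R. inf (f (open_elem (fst p))) (g (open_elem (snd p))))"
      by (metis (no_types, lifting) image_cong)
    moreover have "(\<lambda>p. inf (f (open_elem (fst p))) (g (open_elem (snd p)))) ` R =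
      {inf (f (open_elem V)) (g (open_elem W)) | V W. V \<in> B \<and> W \<in> B \<and> (\<forall>x\<in>V. \<forall>y\<in>W. k x y \<in> U)}"
      by (auto simp: R_def image_def)
    ultimately show "Sup {inf (f (open_elem V)) (g (open_elem W)) | V W.
        V \<in> B \<and> W \<in> B \<and> (\<forall>x\<in>V. \<forall>y\<in>W. k x y \<in> U)} = \<Phi> ?l" by simp
  qed
qed

lemma Phi_INT:
  assumes "countable I" "\<And>i. i \<in> I \<Longrightarrow> A i \<in> sets M"
  shows "\<Phi> (\<Inter>i\<in>I. A i) = (INF i\<in>I. \<Phi> (A i))"
proof -
  have sets: "(\<Union>i\<in>I. - A i) \<in> sets M"
    using assms by (intro sets.countable_UN') auto
  have eq: "(\<Inter>i\<in>I. A i) = - (\<Union>i\<in>I. - A i)" by auto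
  have sets_INT: "(\<Inter>i\<in>I. A i) \<in> sets M" unfolding eq using sets by (rule sets_Compl)
  show ?thesis
  proof (rule order.antisym)
    show "\<Phi> (\<Inter>i\<in>I. A i) \<le> (INF i\<in>I. \<Phi> (A i))"
      using assms sets_INT by (intro ccINF_greatest Phi_mono) auto
    have "- \<Phi> (\<Inter>i\<in>I. A i) = \<Phi> (\<Union>i\<in>I. - A i)"
      using sets unfolding eq by (simp only: Phi_Compl double_compl)
    also have "\<dots> = (SUP i\<in>I. \<Phi> (- A i))"
      by (rule Phi_UN) (use assms in auto)
    also have "\<dots> \<le> - (INF i\<in>I. \<Phi> (A i))"
    proof (rule ccSUP_least)
      fix i assume "i \<in> I"
      with assms have "(INF i\<in>I. \<Phi> (A i)) \<le> \<Phi> (A i)" by (intro ccINF_lower) auto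
      with \<open>i \<in> I\<close> assms show "\<Phi> (- A i) \<le> - (INF i\<in>I. \<Phi> (A i))" by (simp add: Phi_Compl)
    qed (use assms in auto)
    finally show "(INF i\<in>I. \<Phi> (A i)) \<le> \<Phi> (\<Inter>i\<in>I. A i)" by (simp only: compl_le_compl_iff)
  qed
qed

lemma sigma_morphism_Compl: "sigma_morphism h \<Longrightarrow> h (- x) = - h x"
  unfolding sigma_morphism_iff by blast

lemma represents_lower_elem:
  assumes "represents h u" shows "h (lower_elem t) = \<Phi> {\<omega>. u \<omega> \<le> t}"
proof -
  have "h (lower_elem t) = - \<Phi> (u -` {t<..})"
    using assms by (simp add: represents_def lower_elem_def sigma_morphism_Compl)
  also have "\<dots> = \<Phi> (- (u -` {t<..}))"
    using assms by (intro Phi_Compl[symmetric] vimage_sets) (auto simp: represents_def)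
  also have "- (u -` {t<..}) = {\<omega>. u \<omega> \<le> t}" by auto
  finally show ?thesis .
qed

lemma represents_upper_elem:
  assumes "represents h u" shows "h (upper_elem t) = \<Phi> {\<omega>. t \<le> u \<omega>}"
proof -
  have "h (upper_elem t) = - \<Phi> (u -` {..<t})"
    using assms by (simp add: represents_def upper_elem_def sigma_morphism_Compl)
  also have "\<dots> = \<Phi> (- (u -` {..<t}))"
    using assms by (intro Phi_Compl[symmetric] vimage_sets) (auto simp: represents_def)
  also have "- (u -` {..<t}) = {\<omega>. t \<le> u \<omega>}" by auto
  finally show ?thesis .
qed

lemma ennreal_representsI:
  fixes u :: "'w \<Rightarrow> ennreal"
  assumes h: "sigma_morphism h" and u: "u \<in> borel_measurable M"
    and "\<And>t. h (open_elem {t<..}) = \<Phi> (u -` {t<..})"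
  shows "represents h u"
proof -
  have "h (open_elem U) = \<Phi> (u -` U)" if "open U" for U
    by (rule ennreal_frame_morphism_agree[OF open_frame_morphism_of_sigma_morphism[OF h]
          open_frame_morphism_vimage[OF u] _ that]) (use assms(3) in blast)
  with h u show ?thesis by (simp add: represents_def)
qed

text \<open>
  For \<open>q\<close> in a countable dense set choose sets \<open>A q\<close> with \<open>\<Phi> (A q) = h {q<..}\<close>, and let \<open>u \<omega>\<close> be
  the supremum of the \<open>q\<close> with \<open>\<omega> \<in> A q\<close>. The sets \<open>A q\<close> need not decrease in \<open>q\<close>, but \<open>u\<close> exceeds
  \<open>t\<close> exactly on the union of the \<open>A q\<close> with \<open>q > t\<close>, and \<open>\<Phi>\<close> of that union is the right one.
\<close>

lemma ennreal_mfun_represented: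
  fixes h :: "(ennreal, 's) mfun"
  assumes h: "sigma_morphism h"
  shows "\<exists>u. represents h u"
proof -
  obtain D :: "ennreal set" where D: "countable D" "\<And>x y. x < y \<Longrightarrow> \<exists>q\<in>D. x < q \<and> q < y"
    using ennreal_countable_dense by blast
  have "\<forall>q. \<exists>A\<in>sets M. \<Phi> A = h (open_elem {q<..})" using Phi_surj by blast
  then obtain A where A: "\<And>q. A q \<in> sets M" "\<And>q. \<Phi> (A q) = h (open_elem {q<..})" by metis
  define u where "u \<omega> = Sup {q \<in> D. \<omega> \<in> A q}" for \<omega>
  have vimage: "u -` {t<..} = (\<Union>q\<in>D \<inter> {t<..}. A q)" for t
    by (auto simp: u_def less_Sup_iff)
  have u: "u \<in> borel_measurable M"
  proof (rule borel_measurableI_greater)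
    fix t
    have "(\<Union>q\<in>D \<inter> {t<..}. A q) \<in> sets M"
      using D(1) A(1) by (intro sets.countable_UN') auto
    then show "{\<omega> \<in> space M. t < u \<omega>} \<in> sets M"
      unfolding vimage[symmetric] by (simp add: vimage_def)
  qed
  have "h (open_elem {t<..}) = \<Phi> (u -` {t<..})" for t
  proof -
    have "x > t \<longleftrightarrow> (\<exists>q\<in>D \<inter> {t<..}. q < x)" for x
      using D(2)[of t x] by (auto intro: less_trans)
    then have "{t<..} = (\<Union>q\<in>D \<inter> {t<..}. {q<..})" by blast
    then have "h (open_elem {t<..}) = h (open_elem (\<Union>q\<in>D \<inter> {t<..}. {q<..}))" by simp
    also have "\<dots> = (SUP q\<in>D \<inter> {t<..}. h (open_elem {q<..}))"
      using D(1) by (intro open_frame_morphism_UN[OF open_frame_morphism_of_sigma_morphism[OF h]]) auto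
    also have "\<dots> = \<Phi> (\<Union>q\<in>D \<inter> {t<..}. A q)"
      using D(1) A by (subst Phi_UN) auto
    finally show ?thesis unfolding vimage .
  qed
  from ennreal_representsI[OF h u this] show ?thesis by blast
qed

lemma euclidean_representsI:
  fixes u :: "'w \<Rightarrow> 'e::euclidean_space"
  assumes h: "sigma_morphism h" and u: "u \<in> borel_measurable M"
    and box: "\<And>a b. h (open_elem (box a b)) = \<Phi> (u -` box a b)"
  shows "represents h u"
proof -
  have "h (open_elem U) = \<Phi> (u -` U)" if "open U" for U
  proof (rule open_frame_morphism_agree[OF open_frame_morphism_of_sigma_morphism[OF h]
        open_frame_morphism_vimage[OF u]])
    show "generate_topology (range (\<lambda>(a, b). box a b)) U"
      by (subst open_UNION_box[OF that], rule generate_topology.UN)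
        (auto intro: generate_topology.Basis)
  qed (use box in auto)
  with h u show ?thesis by (simp add: represents_def)
qed

lemma sigma_morphism_unary:
  assumes "sigma_morphism f" "continuous_on UNIV k"
  shows "sigma_morphism (mf_unary k f)"
    and "open U \<Longrightarrow> mf_unary k f (open_elem U) = f (open_elem (k -` U))"
  using sigma_extension[OF open_frame_morphism_unary[OF assms]] by (simp_all add: mf_unary_def)

text \<open>
  The exponential map embeds the reals as an open interval into \<open>[0, \<infinity>]\<close>, where suprema always
  exist. The set where the representative of the image takes one of the endpoints \<open>0\<close>
  and \<open>\<infinity>\<close> is sent to \<open>bot\<close> by \<open>\<Phi>\<close>; elsewhere the logarithm gives the function sought.
\<close>

lemma real_mfun_represented:
  fixes h :: "(real, 's) mfun"
  assumes h: "sigma_morphism h"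
  shows "\<exists>u. represents h u"
proof -
  define e :: "real \<Rightarrow> ennreal" where "e x = ennreal (exp x)" for x
  have e: "continuous_on UNIV e"
    unfolding e_def by (intro continuous_on_ennreal continuous_intros)
  note E = sigma_morphism_unary[OF h e]
  obtain w where w: "represents (mf_unary e h) w"
    using ennreal_mfun_represented[OF E(1)] by blast
  then have w_meas [measurable]: "w \<in> borel_measurable M" by (simp add: represents_def)
  have h_vimage: "h (open_elem (e -` U)) = \<Phi> (w -` U)" if "open U" for U
    using w E(2) that by (simp add: represents_def)
  \<comment> \<open>Outside \<open>G\<close>, which \<open>\<Phi>\<close> cannot distinguish from the whole space, \<open>u\<close> has junk values.\<close>
  define G where "G = w -` {0<..<top}"
  have G: "G \<in> sets M" unfolding G_def by (intro vimage_sets w_meas) simp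
  have "e -` {0<..<top} = UNIV" by (auto simp: e_def)
  then have Phi_G: "\<Phi> G = top"
    using h_vimage[of "{0<..<top}"] open_frame_morphism_of_sigma_morphism[OF h]
    by (simp add: G_def open_frame_morphism_def)
  define u where "u \<omega> = ln (enn2real (w \<omega>))" for \<omega>
  have u: "u \<in> borel_measurable M" unfolding u_def by measurable
  have "h (open_elem (box a b)) = \<Phi> (u -` box a b)" for a b
  proof -
    have "e -` {e a<..<e b} = box a b" by (auto simp: e_def box_real ennreal_less_iff)
    then have "h (open_elem (box a b)) = \<Phi> (w -` {e a<..<e b})"
      using h_vimage[of "{e a<..<e b}"] by simp
    also have "w -` {e a<..<e b} = u -` box a b \<inter> G"
    proof (rule set_eqI)
      fix \<omega>
      show "\<omega> \<in> w -` {e a<..<e b} \<longleftrightarrow> \<omega> \<in> u -` box a b \<inter> G"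
      proof (cases "0 < w \<omega> \<and> w \<omega> < top")
        case True
        then obtain r where r: "w \<omega> = ennreal r" "r > 0" by (cases "w \<omega>") auto
        have "a < ln r \<longleftrightarrow> exp a < r" "ln r < b \<longleftrightarrow> r < exp b"
          using r(2) exp_less_cancel_iff[of a "ln r"] exp_less_cancel_iff[of "ln r" b] by simp_all
        with r show ?thesis by (simp add: u_def G_def e_def box_real ennreal_less_iff)
      next
        case False
        moreover have "0 < e a" "e b < top" by (simp_all add: e_def)
        ultimately show ?thesis by (auto simp: G_def intro: less_trans)
      qed
    qed
    also have "\<Phi> \<dots> = \<Phi> (u -` box a b)"
      using G Phi_G vimage_sets[OF u] by (simp add: Phi_Int)
    finally show ?thesis .
  qed
  from euclidean_representsI[OF h u this] show ?thesis by blast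
qed

text \<open>
  Representatives of the real and the imaginary part are combined. The resulting function represents
  \<open>h\<close> because open rectangles, on which both sides split as meets, form a base.
\<close>

lemma complex_mfun_represented:
  fixes h :: "(complex, 's) mfun"
  assumes h: "sigma_morphism h"
  shows "\<exists>u. represents h u"
proof -
  have Re: "continuous_on UNIV Re" and Im: "continuous_on UNIV Im"
    by (auto intro: continuous_intros)
  obtain x where x: "represents (mf_unary Re h) x"
    using real_mfun_represented[OF sigma_morphism_unary(1)[OF h Re]] by blast
  obtain y where y: "represents (mf_unary Im h) y"
    using real_mfun_represented[OF sigma_morphism_unary(1)[OF h Im]] by blast
  define u where "u \<omega> = Complex (x \<omega>) (y \<omega>)" for \<omega>
  have x_meas: "x \<in> borel_measurable M" and y_meas: "y \<in> borel_measurable M"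
    using x y by (auto simp: represents_def)
  have u: "u \<in> borel_measurable M"
    unfolding borel_measurable_complex_iff using x_meas y_meas by (simp add: u_def)
  have "h (open_elem (box a b)) = \<Phi> (u -` box a b)" for a b
  proof -
    define I J where "I = {Re a<..<Re b}" and "J = {Im a<..<Im b}"
    have IJ: "open I" "open J" by (simp_all add: I_def J_def)
    then have vim: "open (Re -` I)" "open (Im -` J)" using Re Im open_vimage by blast+
    have "box a b = Re -` I \<inter> Im -` J" by (auto simp: in_box_complex_iff I_def J_def)
    then have "h (open_elem (box a b)) = inf (h (open_elem (Re -` I))) (h (open_elem (Im -` J)))"
      using open_frame_morphism_of_sigma_morphism[OF h] vim by (simp add: open_frame_morphism_def)
    also have "\<dots> = inf (\<Phi> (x -` I)) (\<Phi> (y -` J))"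
      using x y IJ by (simp add: represents_def sigma_morphism_unary(2)[OF h Re] sigma_morphism_unary(2)[OF h Im])
    also have "\<dots> = \<Phi> (x -` I \<inter> y -` J)"
      using IJ by (simp add: Phi_Int vimage_sets[OF x_meas] vimage_sets[OF y_meas])
    also have "x -` I \<inter> y -` J = u -` box a b"
      by (auto simp: in_box_complex_iff I_def J_def u_def)
    finally show ?thesis .
  qed
  from euclidean_representsI[OF h u this] show ?thesis by blast
qed

end


section \<open>Suprema, infima and the order\<close>

context set_representation
begin

text \<open>
  A measurable function with values in \<open>[0, \<infinity>]\<close> is determined by its values on the intervals
  \<open>[0, t]\<close>. Thus the definite description in \<^const>\<open>mf_SUP\<close> is satisfied by the pointwise supremum
  and by nothing else.
\<close>

lemma represents_SUP:
  assumes F: "\<And>i. i \<in> I \<Longrightarrow> represents (F i) (u i)"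
  shows "represents (mf_SUP I F) (\<lambda>\<omega>. SUP i\<in>I. u i \<omega>)"
proof -
  have u: "u i \<in> borel_measurable M" if "i \<in> I" for i
    using F[OF that] by (simp add: represents_def)
  have u_le: "{\<omega>. u i \<omega> \<le> t} \<in> sets M" if "i \<in> I" for i t
    using vimage_sets[OF u[OF that], of "{..t}"] by (simp add: vimage_def)
  let ?s = "\<lambda>\<omega>. SUP i\<in>I. u i \<omega>"
  have s: "?s \<in> borel_measurable M"
    by (rule borel_measurable_SUP) (use u in auto)
  define G where "G = sigma_extension (\<lambda>U. \<Phi> (?s -` U))"
  have G: "represents G ?s"
    unfolding G_def by (rule represents_sigma_extension[OF s]) simp
  have lower: "G (lower_elem t) = (INF i\<in>I. F i (lower_elem t))" for t
  proof -
    have "G (lower_elem t) = \<Phi> (\<Inter>i\<in>I. {\<omega>. u i \<omega> \<le> t})"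
      unfolding represents_lower_elem[OF G] by (intro arg_cong[of _ _ \<Phi>]) (auto simp: SUP_le_iff)
    also have "\<dots> = (INF i\<in>I. \<Phi> {\<omega>. u i \<omega> \<le> t})"
      by (rule Phi_INT) (use u_le in auto)
    also have "\<dots> = (INF i\<in>I. F i (lower_elem t))"
      using represents_lower_elem[OF F] by (intro arg_cong[of _ _ Inf] image_cong) auto
    finally show ?thesis .
  qed
  have "mf_SUP I F = G"
    unfolding mf_SUP_def
  proof (rule the_equality)
    show *: "sigma_morphism G \<and> (\<forall>t. G (lower_elem t) = (INF i\<in>I. F i (lower_elem t)))"
      using lower G by (simp add: represents_def)
    fix G' assume "sigma_morphism G' \<and> (\<forall>t. G' (lower_elem t) = (INF i\<in>I. F i (lower_elem t)))"
    with * show "G' = G" by (intro ennreal_mfun_eqI) simp_all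
  qed
  with G show ?thesis by simp
qed

lemma represents_INF:
  assumes F: "\<And>i. i \<in> I \<Longrightarrow> represents (F i) (u i)"
  shows "represents (mf_INF I F) (\<lambda>\<omega>. INF i\<in>I. u i \<omega>)"
proof -
  have u: "u i \<in> borel_measurable M" if "i \<in> I" for i
    using F[OF that] by (simp add: represents_def)
  have u_ge: "{\<omega>. t \<le> u i \<omega>} \<in> sets M" if "i \<in> I" for i t
    using vimage_sets[OF u[OF that], of "{t..}"] by (simp add: vimage_def)
  let ?s = "\<lambda>\<omega>. INF i\<in>I. u i \<omega>"
  have s: "?s \<in> borel_measurable M"
    by (rule borel_measurable_INF) (use u in auto)
  define G where "G = sigma_extension (\<lambda>U. \<Phi> (?s -` U))"
  have G: "represents G ?s"
    unfolding G_def by (rule represents_sigma_extension[OF s]) simp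
  have upper: "G (upper_elem t) = (INF i\<in>I. F i (upper_elem t))" for t
  proof -
    have "G (upper_elem t) = \<Phi> (\<Inter>i\<in>I. {\<omega>. t \<le> u i \<omega>})"
      unfolding represents_upper_elem[OF G] by (intro arg_cong[of _ _ \<Phi>]) (auto simp: le_INF_iff)
    also have "\<dots> = (INF i\<in>I. \<Phi> {\<omega>. t \<le> u i \<omega>})"
      by (rule Phi_INT) (use u_ge in auto)
    also have "\<dots> = (INF i\<in>I. F i (upper_elem t))"
      using represents_upper_elem[OF F] by (intro arg_cong[of _ _ Inf] image_cong) auto
    finally show ?thesis .
  qed
  have "mf_INF I F = G"
    unfolding mf_INF_def
  proof (rule the_equality)
    show *: "sigma_morphism G \<and> (\<forall>t. G (upper_elem t) = (INF i\<in>I. F i (upper_elem t)))"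
      using upper G by (simp add: represents_def)
    fix G' assume "sigma_morphism G' \<and> (\<forall>t. G' (upper_elem t) = (INF i\<in>I. F i (upper_elem t)))"
    with * show "G' = G" by (intro ennreal_mfun_eqI) simp_all
  qed
  with G show ?thesis by simp
qed

lemma represents_limsup:
  assumes "\<And>i. represents (F i) (u i)"
  shows "represents (mf_limsup F) (\<lambda>\<omega>. limsup (\<lambda>i. u i \<omega>))"
  unfolding mf_limsup_def limsup_INF_SUP
  by (intro represents_INF represents_SUP assms)

lemma mf_leI:
  assumes "represents f u" "represents g v" "\<And>\<omega>. u \<omega> \<le> v \<omega>"
  shows "mf_le f g"
proof -
  have sets: "{\<omega>. w \<omega> \<le> t} \<in> sets M" if "represents h w" for h w and t :: ennreal
    using vimage_sets[of w "{..t}"] that by (simp add: represents_def vimage_def)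
  show ?thesis
    unfolding mf_le_def represents_lower_elem[OF assms(1)] represents_lower_elem[OF assms(2)]
    by (intro allI Phi_mono sets[OF assms(1)] sets[OF assms(2)]) (use assms(3) order.trans in blast)
qed

end

context measured_representation
begin

lemma AE_notin:
  assumes "A \<in> sets M" "\<Phi> A = bot"
  shows "AE \<omega> in M. \<omega> \<notin> A"
  by (rule AE_I[of _ _ A]) (use assms mu emeasure_M in \<open>auto simp: is_measure_def\<close>)

text \<open>
  The set where \<open>u > v\<close> is the union, over a countable dense set of numbers \<open>q\<close>, of the sets where
  \<open>v \<le> q < u\<close>, and \<open>\<Phi>\<close> annihilates each of these.
\<close>

lemma mf_le_AE:
  fixes u v :: "'w \<Rightarrow> ennreal"
  assumes f: "represents f u" and g: "represents g v" and le: "mf_le f g"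
  shows "AE \<omega> in M. u \<omega> \<le> v \<omega>"
proof -
  obtain D :: "ennreal set" where D: "countable D" "\<And>x y. x < y \<Longrightarrow> \<exists>q\<in>D. x < q \<and> q < y"
    using ennreal_countable_dense by blast
  have u: "u \<in> borel_measurable M" and v: "v \<in> borel_measurable M"
    using f g by (simp_all add: represents_def)
  have "AE \<omega> in M. \<omega> \<notin> v -` {..q} \<inter> - (u -` {..q})" for q
  proof (rule AE_notin)
    have sets: "v -` {..q} \<in> sets M" "u -` {..q} \<in> sets M"
      using vimage_sets[OF u] vimage_sets[OF v] by simp_all
    then show "v -` {..q} \<inter> - (u -` {..q}) \<in> sets M" by auto
    have "\<Phi> (v -` {..q}) \<le> \<Phi> (u -` {..q})"
      using le[unfolded mf_le_def, rule_format, of q, unfolded represents_lower_elem[OF f] represents_lower_elem[OF g]]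
      by (simp add: vimage_def)
    then show "\<Phi> (v -` {..q} \<inter> - (u -` {..q})) = bot"
      using sets by (simp add: Phi_Int Phi_Compl inf_shunt)
  qed
  then have "AE \<omega> in M. \<forall>q\<in>D. \<omega> \<notin> v -` {..q} \<inter> - (u -` {..q})"
    using D(1) by (simp add: AE_ball_countable)
  then show ?thesis
  proof eventually_elim
    case (elim \<omega>)
    show ?case
    proof (rule ccontr)
      assume "\<not> u \<omega> \<le> v \<omega>"
      then obtain q where "q \<in> D" "v \<omega> < q" "q < u \<omega>" using D(2)[of "v \<omega>" "u \<omega>"] by (auto simp: not_le)
      with elim show False by auto
    qed
  qed
qed

end


section \<open>Simple functions and the integral\<close>

lemma sigma_morphism_belowD:
  assumes "sigma_morphism_below e e' f"
  shows "x \<le> e \<Longrightarrow> f x \<le> e'" "x \<le> y \<Longrightarrow> y \<le> e \<Longrightarrow> f x \<le> f y" "f bot = bot" "f e = e'"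
    "x \<le> e \<Longrightarrow> f (e - x) = e' - f x"
    "(\<And>i::nat. a i \<le> e) \<Longrightarrow> f (SUP i. a i) = (SUP i. f (a i))"
  using assms unfolding sigma_morphism_below_def by blast+

lemma sigma_morphism_below_comp:
  fixes p :: "'a::abstract_sigma_algebra \<Rightarrow> 'b::abstract_sigma_algebra" and s :: "'b \<Rightarrow> 'c::abstract_sigma_algebra"
  assumes "sigma_morphism_below e e' p" "sigma_morphism_below e' e'' s"
  shows "sigma_morphism_below e e'' (s \<circ> p)"
proof -
  note p = sigma_morphism_belowD[OF assms(1)] and s = sigma_morphism_belowD[OF assms(2)]
  show ?thesis
    unfolding sigma_morphism_below_def comp_def
  proof (intro conjI allI impI)
    show "s (p (SUP i. x i)) = (SUP i. s (p (x i)))" if "\<forall>i. x i \<le> e" for x :: "nat \<Rightarrow> 'a"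
      using that p(1) s(6)[of "\<lambda>i. p (x i)"] p(6)[of x] by simp
    show "s (p x) \<le> s (p y)" if "x \<le> y \<and> y \<le> e" for x y
      using that p(1,2) s(2) by blast
  qed (simp_all add: p s)
qed

text \<open>
  A field of sets represents itself. For the power set of the naturals this yields the points that
  induce a given morphism.
\<close>

lemma set_representation_id: "set_representation (count_space UNIV) (\<lambda>A. A)"
  by unfold_locales auto

text \<open>
  Extend \<open>p\<close> to a morphism into all sets of naturals by sending each \<open>j > n\<close> wherever \<open>n\<close> goes. As
  a measurable function on the power set of the naturals it is represented by a function \<open>x\<close> there,
  and its values are the points.
\<close>

lemma simple_points_exist:
  assumes p: "sigma_morphism_below top {..n} p"
  shows "\<exists>x::nat \<Rightarrow> ennreal. \<forall>U. open U \<longrightarrow> p (open_elem U) = {i \<in> {..n}. x i \<in> U}"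
proof -
  note D = sigma_morphism_belowD[OF p]
  have le: "p a \<subseteq> {..n}" for a
    using D(1)[of a] by simp
  define h where "h a = (\<lambda>j. min j n) -` p a" for a
  have p_Compl: "p (- a) = {..n} - p a" for a
    using D(5)[of a] by (simp add: diff_eq)
  have "sigma_morphism h"
    unfolding sigma_morphism_iff
  proof (intro conjI allI)
    show "mono h"
      using D(2) unfolding mono_def h_def by (intro allI impI vimage_mono) simp
    show "h bot = bot"
      unfolding h_def D(3) by (simp only: vimage_empty)
    show "h top = top"
      unfolding h_def D(4) by (simp add: vimage_def)
    show "h (- a) = - h a" for a
      unfolding h_def p_Compl by (simp add: vimage_Diff vimage_def set_eq_iff)
    show "h (SUP i. a i) = (SUP i. h (a i))" for a :: "nat \<Rightarrow> _"
      using D(6)[of a] unfolding h_def by (simp add: vimage_UN)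
  qed
  from set_representation.ennreal_mfun_represented[OF set_representation_id this]
  obtain x where x: "\<And>U. open U \<Longrightarrow> h (open_elem U) = x -` U"
    unfolding set_representation.represents_def[OF set_representation_id] by blast
  have "p (open_elem U) = {i \<in> {..n}. x i \<in> U}" if "open U" for U
  proof -
    have "i \<in> p (open_elem U) \<longleftrightarrow> x i \<in> U" if "i \<le> n" for i
    proof -
      have "i \<in> h (open_elem U) \<longleftrightarrow> x i \<in> U" by (simp add: x[OF \<open>open U\<close>])
      with that show ?thesis by (simp add: h_def min_absorb1)
    qed
    then show ?thesis using le[of "open_elem U"] by blast
  qed
  then show ?thesis by blast
qed

context set_representation
begin

text \<open>
  If \<open>v\<close> takes the values \<open>x 0, ..., x n\<close>, it is the composition of \<open>x\<close> with a map \<open>k\<close> into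
  \<open>{..n}\<close>; taking preimages under \<open>x\<close> and under \<open>k\<close> gives the two factors.
\<close>

lemma simple_function_represents_simple:
  assumes v: "simple_function M v"
  shows "\<exists>f. represents f v \<and> simple_mf f"
proof -
  have "finite (range v)" using simple_functionD(1)[OF v] by simp
  from finite_imp_nat_seg_image_inj_on[OF this] obtain m and x :: "nat \<Rightarrow> ennreal"
    where m: "range v = x ` {i. i < m}" by blast
  have "range v \<noteq> {}" by simp
  with m have "m \<noteq> 0" by (intro notI) simp
  then obtain n where n: "m = Suc n" by (cases m) auto
  have ex: "\<exists>i. i \<le> n \<and> x i = v \<omega>" for \<omega>
  proof -
    have "v \<omega> \<in> x ` {i. i < Suc n}" using rangeI[of v \<omega>] by (simp only: m n)
    then obtain i where "i < Suc n" "v \<omega> = x i" by blast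
    then show ?thesis by (intro exI[of _ i]) simp
  qed
  \<comment> \<open>The index depends on the value alone, so that preimages under \<open>k\<close> are preimages under \<open>v\<close>.\<close>
  define \<kappa> where "\<kappa> y = (SOME i. i \<le> n \<and> x i = y)" for y
  have \<kappa>: "\<kappa> (v \<omega>) \<le> n" "x (\<kappa> (v \<omega>)) = v \<omega>" for \<omega>
    using someI_ex[OF ex[of \<omega>]] unfolding \<kappa>_def by blast+
  define k where "k \<omega> = \<kappa> (v \<omega>)" for \<omega>
  have k: "k \<omega> \<le> n" "x (k \<omega>) = v \<omega>" for \<omega> using \<kappa> by (auto simp: k_def)
  have k_sets: "k -` I \<in> sets M" for I
    using simple_functionD(2)[OF v, of "\<kappa> -` I"] by (simp add: k_def vimage_def)
  define s where "s I = \<Phi> (k -` I)" for I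
  have s: "sigma_morphism_below {..n} top s"
  proof -
    have compl: "k -` ({..n} - I) = - (k -` I)" and total: "k -` {..n} = UNIV" for I
      using k(1) by auto
    show ?thesis
      unfolding sigma_morphism_below_def
    proof (intro conjI allI impI)
      show "s I \<le> s J" if "I \<le> J \<and> J \<le> {..n}" for I J
        unfolding s_def using that by (intro Phi_mono k_sets vimage_mono) simp
      show "s ({..n} - I) = top - s I" for I
        using Phi_Compl[OF k_sets[of I]] unfolding s_def compl by (simp only: diff_eq inf_top_left)
      show "s (SUP i. I i) = (SUP i. s (I i))" for I :: "nat \<Rightarrow> _"
        unfolding s_def vimage_UN by (rule Phi_UN_nat[OF k_sets])
    qed (simp_all add: s_def total)
  qed
  define q where "q = sigma_extension (\<lambda>U. x -` U)"
  have "set_representation.represents (count_space UNIV) (\<lambda>A. A) q x"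
    unfolding q_def by (rule set_representation.represents_sigma_extension[OF set_representation_id]) auto
  then have q: "sigma_morphism q" and q_open: "\<And>U. open U \<Longrightarrow> q (open_elem U) = x -` U"
    unfolding set_representation.represents_def[OF set_representation_id] by blast+
  define p where "p a = q a \<inter> {..n}" for a
  have p: "sigma_morphism_below top {..n} p"
  proof -
    have q': "mono q" "q bot = bot" "q top = top" "\<And>a. q (- a) = - q a"
      "\<And>a. q (SUP i::nat. a i) = (SUP i. q (a i))"
      using q unfolding sigma_morphism_iff by blast+
    show ?thesis
      unfolding sigma_morphism_below_def
    proof (intro conjI allI impI)
      show "p a \<le> p b" if "a \<le> b \<and> b \<le> top" for a b
        using monoD[OF q'(1), of a b] that by (auto simp: p_def)
      show "p (top - a) = {..n} - p a" for a
        using q'(4)[of a] by (auto simp: p_def diff_eq)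
      show "p (SUP i. a i) = (SUP i. p (a i))" for a :: "nat \<Rightarrow> _"
        using q'(5)[of a] by (auto simp: p_def)
    qed (simp_all add: p_def q'(2,3))
  qed
  define f where "f = sigma_extension (\<lambda>U. \<Phi> (v -` U))"
  have f: "represents f v"
    unfolding f_def by (rule represents_sigma_extension[OF borel_measurable_simple_function[OF v]]) simp
  have "f = s \<circ> p"
  proof (rule sigma_morphism_eqI)
    show "sigma_morphism f" using f by (simp add: represents_def)
    show "sigma_morphism (s \<circ> p)" by (rule sigma_morphism_below_comp[OF p s])
    fix U :: "ennreal set" assume U: "open U"
    have "k -` (x -` U \<inter> {..n}) = v -` U" using k by auto
    with f U show "f (open_elem U) = (s \<circ> p) (open_elem U)"
      by (simp add: represents_def s_def p_def q_open)
  qed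
  with p s have "simple_mf f" by (auto simp: simple_mf_def simple_factorization_def)
  with f show ?thesis by blast
qed

end

context measured_representation
begin

text \<open>
  Choose sets \<open>S i\<close> with \<open>\<Phi> (S i) = s {i}\<close>. Up to null sets they partition the space and \<open>u\<close> is equal
  to \<open>x i\<close> on \<open>S i\<close>, because \<open>\<Phi>\<close> sends all exceptional sets to \<open>bot\<close>. In particular the sum is the
  same for all factorizations of \<open>f\<close>.
\<close>

lemma simple_factorization_integral:
  assumes fact: "simple_factorization f n p s"
    and p: "\<And>U. open U \<Longrightarrow> p (open_elem U) = {i \<in> {..n}. x i \<in> U}"
    and f: "represents f u"
  shows "(\<Sum>i\<le>n. \<mu> (s {i}) * x i) = (\<integral>\<^sup>+\<omega>. u \<omega> \<partial>M)"
proof -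
  have s: "sigma_morphism_below {..n} top s" and f_eq: "f = s \<circ> p"
    using fact by (auto simp: simple_factorization_def)
  note sD = sigma_morphism_belowD[OF s]
  have s_mono: "s I \<le> s J" if "I \<subseteq> J" "J \<subseteq> {..n}" for I J
    using that by (rule sD(2))
  have s_disj: "inf (s I) (s J) = bot" if "I \<subseteq> {..n}" "J \<subseteq> {..n}" "I \<inter> J = {}" for I J
  proof -
    have "s I \<le> s ({..n} - J)" using that by (intro s_mono) auto
    also have "\<dots> = - s J" using sD(5)[OF that(2)] by (simp add: diff_eq)
    finally show ?thesis by (simp add: inf_shunt)
  qed
  have u: "u \<in> borel_measurable M" using f by (simp add: represents_def)
  have "\<forall>i. \<exists>A\<in>sets M. \<Phi> A = s {i}" using Phi_surj by blast
  then obtain S where S: "\<And>i. S i \<in> sets M" "\<And>i. \<Phi> (S i) = s {i}" by metis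
  have val: "AE \<omega> in M. \<omega> \<notin> S i \<inter> u -` (- {x i})" if "i \<le> n" for i
  proof (rule AE_notin)
    have "u -` (- {x i}) \<in> sets M" by (rule vimage_sets[OF u]) simp
    with S(1) show "S i \<inter> u -` (- {x i}) \<in> sets M" by auto
    have "open (- {x i})" by (simp add: open_Compl)
    then have "\<Phi> (u -` (- {x i})) = f (open_elem (- {x i}))"
      using f by (simp add: represents_def)
    also have "\<dots> = s {j \<in> {..n}. x j \<in> - {x i}}"
      unfolding f_eq comp_def p[OF \<open>open (- {x i})\<close>] ..
    finally have "\<Phi> (S i \<inter> u -` (- {x i})) = inf (s {i}) (s {j \<in> {..n}. x j \<in> - {x i}})"
      using S \<open>u -` (- {x i}) \<in> sets M\<close> by (simp add: Phi_Int)
    also have "\<dots> = bot" using that by (intro s_disj) auto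
    finally show "\<Phi> (S i \<inter> u -` (- {x i})) = bot" .
  qed
  have disj: "AE \<omega> in M. \<omega> \<notin> S i \<inter> S j" if "i \<le> n" "j \<le> n" "i \<noteq> j" for i j
  proof (rule AE_notin)
    show "S i \<inter> S j \<in> sets M" using S(1) by auto
    show "\<Phi> (S i \<inter> S j) = bot"
      using s_disj[of "{i}" "{j}"] that S by (simp add: Phi_Int)
  qed
  have cover: "AE \<omega> in M. \<omega> \<notin> - (\<Union>i\<le>n. S i)"
  proof (rule AE_notin)
    have T: "(\<Union>i\<le>n. S i) \<in> sets M" using S(1) by auto
    then show "- (\<Union>i\<le>n. S i) \<in> sets M" by (rule sets_Compl)
    \<comment> \<open>The morphism \<open>s\<close> is known to preserve joins of infinite sequences, hence a sequence that is empty beyond \<open>n\<close>.\<close>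
    have "(\<Union>k. {k} \<inter> {..n}) = {..n}" by auto
    then have "top = s (\<Union>k. {k} \<inter> {..n})" using sD(4) by simp
    also have "\<dots> = (SUP k. s ({k} \<inter> {..n}))"
      by (rule sD(6)) simp
    also have "\<dots> \<le> \<Phi> (\<Union>i\<le>n. S i)"
    proof (rule ccSUP_least)
      fix k
      show "s ({k} \<inter> {..n}) \<le> \<Phi> (\<Union>i\<le>n. S i)"
      proof (cases "k \<le> n")
        case True
        then have "\<Phi> (S k) \<le> \<Phi> (\<Union>i\<le>n. S i)" using S(1) T by (intro Phi_mono) auto
        with True S(2) show ?thesis by simp
      next
        case False
        then have "{k} \<inter> {..n} = bot" by auto
        then show ?thesis using sD(3) by simp
      qed
    qed simp
    finally show "\<Phi> (- (\<Union>i\<le>n. S i)) = bot" unfolding Phi_Compl[OF T] by (simp add: top_unique)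
  qed
  have "AE \<omega> in M. \<forall>i\<in>{..n}. \<omega> \<notin> S i \<inter> u -` (- {x i})"
    using val by (simp add: AE_ball_countable)
  moreover have "AE \<omega> in M. \<forall>i\<in>{..n}. \<forall>j\<in>{..n}. i \<noteq> j \<longrightarrow> \<omega> \<notin> S i \<inter> S j"
    using disj by (simp add: AE_ball_countable)
  ultimately have "AE \<omega> in M. u \<omega> = (\<Sum>i\<le>n. x i * indicator (S i) \<omega>)"
    using cover
  proof eventually_elim
    case (elim \<omega>)
    then obtain i where i: "i \<le> n" "\<omega> \<in> S i" by auto
    have "(\<Sum>j\<le>n. x j * indicator (S j) \<omega>) = (\<Sum>j\<in>{..n}. if j = i then x i else 0)"
      using elim(2) i by (intro sum.cong) (auto simp: indicator_def)
    also have "\<dots> = x i" using i(1) by simp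
    also have "\<dots> = u \<omega>" using elim(1) i by auto
    finally show ?case ..
  qed
  then have "(\<integral>\<^sup>+\<omega>. u \<omega> \<partial>M) = (\<integral>\<^sup>+\<omega>. (\<Sum>i\<le>n. x i * indicator (S i) \<omega>) \<partial>M)"
    by (rule nn_integral_cong_AE)
  also have "\<dots> = (\<Sum>i\<le>n. \<integral>\<^sup>+\<omega>. x i * indicator (S i) \<omega> \<partial>M)"
    using S(1) by (intro nn_integral_sum) auto
  also have "\<dots> = (\<Sum>i\<le>n. \<mu> (s {i}) * x i)"
    using S by (simp add: nn_integral_cmult_indicator emeasure_M mult.commute)
  finally show ?thesis ..
qed

lemma simple_integral_eq_nn_integral:
  assumes "simple_mf f" "represents f u"
  shows "simple_integral \<mu> f = (\<integral>\<^sup>+\<omega>. u \<omega> \<partial>M)"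
proof -
  from assms(1) obtain n p s where fact: "simple_factorization f n p s"
    by (auto simp: simple_mf_def)
  then have "sigma_morphism_below top {..n} p" by (simp add: simple_factorization_def)
  from simple_points_exist[OF this] obtain x
    where x: "\<forall>U. open U \<longrightarrow> p (open_elem U) = {i \<in> {..n}. x i \<in> U}" by blast
  let ?P = "\<lambda>r. \<exists>n p s x. simple_factorization f n p s \<and>
    (\<forall>U. open U \<longrightarrow> p (open_elem U) = {i \<in> {..n}. x i \<in> U}) \<and> r = (\<Sum>i\<le>n. \<mu> (s {i}) * x i)"
  have unique: "r = (\<integral>\<^sup>+\<omega>. u \<omega> \<partial>M)" if "?P r" for r
  proof -
    from that obtain n p s x where *: "simple_factorization f n p s"
      "\<And>U. open U \<Longrightarrow> p (open_elem U) = {i \<in> {..n}. x i \<in> U}" "r = (\<Sum>i\<le>n. \<mu> (s {i}) * x i)"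
      by blast
    from simple_factorization_integral[OF *(1,2) assms(2)] *(3) show ?thesis by simp
  qed
  have "?P (\<Sum>i\<le>n. \<mu> (s {i}) * x i)"
    using fact x by blast
  with unique[OF this] have "?P (\<integral>\<^sup>+\<omega>. u \<omega> \<partial>M)" by simp
  with unique show ?thesis
    unfolding simple_integral_def by (intro the_equality)
qed

text \<open>
  Both integrals are suprema over simple functions below the given one. Because \<open>\<Phi>\<close> is onto, every
  simple function of the algebra has a representative, which lies below \<open>u\<close> almost everywhere;
  conversely every simple function on the points represents a simple function of the algebra.
\<close>

theorem mf_integral_eq_nn_integral:
  assumes f: "represents f u"
  shows "mf_integral \<mu> f = (\<integral>\<^sup>+\<omega>. u \<omega> \<partial>M)"
proof (rule order.antisym)
  show "mf_integral \<mu> f \<le> (\<integral>\<^sup>+\<omega>. u \<omega> \<partial>M)"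
    unfolding mf_integral_def
  proof (rule Sup_least)
    fix r assume "r \<in> {simple_integral \<mu> g | g. mf_le g f \<and> simple_mf g}"
    then obtain g where g: "r = simple_integral \<mu> g" "mf_le g f" "simple_mf g" by blast
    then have "sigma_morphism g"
      using sigma_morphism_below_comp by (auto simp: simple_mf_def simple_factorization_def)
    then obtain v where v: "represents g v" using ennreal_mfun_represented by blast
    have "(\<integral>\<^sup>+\<omega>. v \<omega> \<partial>M) \<le> (\<integral>\<^sup>+\<omega>. u \<omega> \<partial>M)"
      by (rule nn_integral_mono_AE[OF mf_le_AE[OF v f g(2)]])
    with g v show "r \<le> (\<integral>\<^sup>+\<omega>. u \<omega> \<partial>M)" by (simp add: simple_integral_eq_nn_integral)
  qed
  show "(\<integral>\<^sup>+\<omega>. u \<omega> \<partial>M) \<le> mf_integral \<mu> f"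
    unfolding nn_integral_def
  proof (rule SUP_least)
    fix v assume "v \<in> {v. simple_function M v \<and> v \<le> u}"
    then have v: "simple_function M v" "\<And>\<omega>. v \<omega> \<le> u \<omega>" by (auto simp: le_fun_def)
    obtain g where g: "represents g v" "simple_mf g"
      using simple_function_represents_simple[OF v(1)] by blast
    have "integral\<^sup>S M v = simple_integral \<mu> g"
      using g v(1) by (simp add: simple_integral_eq_nn_integral nn_integral_eq_simple_integral)
    also have "\<dots> \<le> mf_integral \<mu> f"
      unfolding mf_integral_def using g mf_leI[OF g(1) f v(2)] by (intro Sup_upper) blast
    finally show "integral\<^sup>S M v \<le> mf_integral \<mu> f" .
  qed
qed

end


section \<open>Complex integrals and dominated convergence\<close>

context measured_representation
begin

lemma represents_abs: "represents f u \<Longrightarrow> represents (mf_abs f) (\<lambda>\<omega>. ennreal (cmod (u \<omega>)))"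
  unfolding mf_abs_def
  by (rule represents_unary[where k = "\<lambda>z. ennreal (cmod z)"])
    (auto intro!: continuous_on_ennreal continuous_intros)

lemma represents_diff:
  "represents f u \<Longrightarrow> represents g v \<Longrightarrow> represents (mf_diff f g) (\<lambda>\<omega>. u \<omega> - v \<omega>)"
  unfolding mf_diff_def by (rule represents_binary) (auto intro!: continuous_intros)

lemma real_mf_integral_eq_integral:
  assumes f: "represents f u" and u: "integrable M u"
  shows "real_mf_integral \<mu> f = (\<integral>\<omega>. u \<omega> \<partial>M)"
proof -
  have "represents (mf_binary max f (mf_const 0)) (\<lambda>\<omega>. max (u \<omega>) 0)"
    by (rule represents_binary[OF f represents_const]) (auto intro!: continuous_intros)
  then have "represents (mf_pos f) (\<lambda>\<omega>. ennreal (max (u \<omega>) 0))"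
    unfolding mf_pos_def by (rule represents_unary) (auto intro!: continuous_on_ennreal continuous_intros)
  moreover have "ennreal (max r 0) = ennreal r" for r
    by (simp add: max_def ennreal_neg)
  ultimately have pos: "represents (mf_pos f) (\<lambda>\<omega>. ennreal (u \<omega>))" by simp
  have "represents (mf_binary min f (mf_const 0)) (\<lambda>\<omega>. min (u \<omega>) 0)"
    by (rule represents_binary[OF f represents_const]) (auto intro!: continuous_intros)
  then have "represents (mf_unary uminus (mf_binary min f (mf_const 0))) (\<lambda>\<omega>. - min (u \<omega>) 0)"
    by (rule represents_unary) (auto intro!: continuous_intros)
  then have "represents (mf_neg f) (\<lambda>\<omega>. ennreal (- min (u \<omega>) 0))"
    unfolding mf_neg_def by (rule represents_unary) (auto intro!: continuous_on_ennreal continuous_intros)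
  moreover have "ennreal (- min r 0) = ennreal (- r)" for r
    by (simp add: min_def ennreal_neg)
  ultimately have neg: "represents (mf_neg f) (\<lambda>\<omega>. ennreal (- u \<omega>))" by simp
  show ?thesis
    unfolding real_mf_integral_def mf_integral_eq_nn_integral[OF pos] mf_integral_eq_nn_integral[OF neg]
    by (rule real_lebesgue_integral_def[OF u, symmetric])
qed

lemma complex_mf_integral_eq_integral:
  assumes f: "represents f u" and u: "integrable M u"
  shows "complex_mf_integral \<mu> f = (\<integral>\<omega>. u \<omega> \<partial>M)"
proof -
  have Re: "represents (mf_unary Re f) (\<lambda>\<omega>. Re (u \<omega>))"
    by (rule represents_unary[OF f]) (auto intro!: continuous_intros)
  have Im: "represents (mf_unary Im f) (\<lambda>\<omega>. Im (u \<omega>))"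
    by (rule represents_unary[OF f]) (auto intro!: continuous_intros)
  show ?thesis
    unfolding complex_mf_integral_def
    using real_mf_integral_eq_integral[OF Re] real_mf_integral_eq_integral[OF Im] u
    by (simp add: complex_eq_iff)
qed

text \<open>
  The upper limit of the \<open>|F n - f|\<close> is represented by the pointwise upper limit. If it is the
  constant \<open>0\<close>, then \<open>\<Phi>\<close> sends the set where it is positive to \<open>bot\<close>.
\<close>

lemma mf_tendsto_AE:
  assumes F: "\<And>n. represents (F n) (v n)" and f: "represents f u" and lim: "mf_tendsto F f"
  shows "AE \<omega> in M. (\<lambda>n. v n \<omega>) \<longlonglongrightarrow> u \<omega>"
proof -
  let ?l = "\<lambda>\<omega>. limsup (\<lambda>n. ennreal (cmod (v n \<omega> - u \<omega>)))"
  have "represents (mf_limsup (\<lambda>n. mf_abs (mf_diff (F n) f))) ?l"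
    by (intro represents_limsup represents_abs represents_diff F f)
  then have l: "represents (mf_const 0) ?l"
    using lim by (simp add: mf_tendsto_def)
  have "?l -` {0<..} \<in> sets M"
    using l by (intro vimage_sets) (auto simp: represents_def)
  moreover have "\<Phi> (?l -` {0<..}) = bot"
  proof -
    have "\<Phi> (?l -` {0<..}) = mf_const 0 (open_elem {0::ennreal<..})"
      using l by (simp add: represents_def)
    also have "\<dots> = \<Phi> ((\<lambda>_. 0) -` {0::ennreal<..})"
      using represents_const[of "0::ennreal"] by (simp add: represents_def)
    finally show ?thesis by simp
  qed
  ultimately have "AE \<omega> in M. \<omega> \<notin> ?l -` {0<..}" by (rule AE_notin)
  then show ?thesis
  proof eventually_elim
    case (elim \<omega>)
    then have "?l \<omega> = 0" by simp
    then have "(\<lambda>n. ennreal (cmod (v n \<omega> - u \<omega>))) \<longlonglongrightarrow> 0"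
      by (rule tendsto_0_if_Limsup_eq_0_ennreal)
    then have "(\<lambda>n. cmod (v n \<omega> - u \<omega>)) \<longlonglongrightarrow> 0"
      by (simp add: ennreal_tendsto_0_iff)
    then have "(\<lambda>n. v n \<omega> - u \<omega>) \<longlonglongrightarrow> 0" by (rule tendsto_norm_zero_cancel)
    then show ?case by (rule LIM_zero_cancel)
  qed
qed

end

theorem theorem12:
  fixes \<mu> :: "'s::abstract_sigma_algebra \<Rightarrow> ennreal"
    and f :: "(complex, 's) mfun"
    and F :: "nat \<Rightarrow> (complex, 's) mfun"
    and g :: "(ennreal, 's) mfun"
  assumes "is_measure \<mu>"
    and "sigma_morphism f"
    and "\<And>n. sigma_morphism (F n)"
    and "mf_tendsto F f"
    and "sigma_morphism g"
    and "mf_integrable \<mu> g"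
    and "\<And>n. mf_le (mf_abs (F n)) g"
  shows "complex_mf_integrable \<mu> f \<and>
    (\<lambda>n. mf_integral \<mu> (mf_abs (mf_diff (F n) f))) \<longlonglongrightarrow> 0 \<and>
    (\<lambda>n. complex_mf_integral \<mu> (F n)) \<longlonglongrightarrow> complex_mf_integral \<mu> f"
proof -
  obtain M :: "'s set measure" and \<Phi> where "measured_representation M \<Phi> \<mu>"
    using loomis_sikorski[OF assms(1)] by blast
  then interpret measured_representation M \<Phi> \<mu> .
  obtain u where u: "represents f u" using complex_mfun_represented[OF assms(2)] by blast
  have "\<forall>n. \<exists>v. represents (F n) v" using complex_mfun_represented[OF assms(3)] by blast
  then obtain v where v: "\<And>n. represents (F n) (v n)" by metis
  obtain w where w: "represents g w" using ennreal_mfun_represented[OF assms(5)] by blast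
  have u_meas [measurable]: "u \<in> borel_measurable M" and v_meas [measurable]: "\<And>n. v n \<in> borel_measurable M"
    and w_meas [measurable]: "w \<in> borel_measurable M"
    using u v w by (simp_all add: represents_def)
  have w_finite: "(\<integral>\<^sup>+\<omega>. w \<omega> \<partial>M) < \<infinity>"
    using assms(6) by (simp add: mf_integrable_def mf_integral_eq_nn_integral[OF w])
  then have w_AE: "AE \<omega> in M. w \<omega> \<noteq> \<infinity>"
    by (intro nn_integral_noteq_infinite) auto
  \<comment> \<open>The classical theorem asks for a real-valued bound; \<open>w\<close> is infinite only on a null set.\<close>
  define b where "b \<omega> = enn2real (w \<omega>)" for \<omega>
  have b_meas [measurable]: "b \<in> borel_measurable M" unfolding b_def by measurable
  have b_eq: "AE \<omega> in M. ennreal (b \<omega>) = w \<omega>"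
    using w_AE by eventually_elim (simp add: b_def less_top)
  have b_finite: "(\<integral>\<^sup>+\<omega>. b \<omega> \<partial>M) < \<infinity>"
    using w_finite nn_integral_cong_AE[OF b_eq] by simp
  have b: "integrable M b"
    using b_finite by (intro integrableI_nonneg) (auto simp: b_def)
  have bound: "AE \<omega> in M. norm (v n \<omega>) \<le> b \<omega>" for n
    using mf_le_AE[OF represents_abs[OF v[of n]] w assms(7)[of n]] b_eq
  proof eventually_elim
    case (elim \<omega>)
    then have "ennreal (norm (v n \<omega>)) \<le> ennreal (b \<omega>)" by simp
    then show ?case by (simp add: b_def ennreal_le_iff)
  qed
  have lim: "AE \<omega> in M. (\<lambda>n. v n \<omega>) \<longlonglongrightarrow> u \<omega>"
    by (rule mf_tendsto_AE[OF v u assms(4)])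
  note dominated = u_meas v_meas b lim bound
  have u_int: "integrable M u"
    by (rule integrable_dominated_convergence[OF dominated])
  have v_int: "integrable M (v n)" for n
    by (rule integrable_dominated_convergence2[OF dominated])
  have "complex_mf_integrable \<mu> f"
    using u_int
    by (simp add: complex_mf_integrable_def mf_integrable_def
        mf_integral_eq_nn_integral[OF represents_abs[OF u]] integrable_iff_bounded)
  moreover have "(\<lambda>n. mf_integral \<mu> (mf_abs (mf_diff (F n) f))) \<longlonglongrightarrow> 0"
  proof -
    have "(\<lambda>n. \<integral>\<^sup>+\<omega>. norm (u \<omega> - v n \<omega>) \<partial>M) \<longlonglongrightarrow> 0"
      by (rule nn_integral_dominated_convergence_norm[where w = b])
        (use bound b_finite lim in auto)
    then show ?thesis
      by (simp add: mf_integral_eq_nn_integral[OF represents_abs[OF represents_diff[OF v u]]]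
          norm_minus_commute)
  qed
  moreover have "(\<lambda>n. complex_mf_integral \<mu> (F n)) \<longlonglongrightarrow> complex_mf_integral \<mu> f"
    unfolding complex_mf_integral_eq_integral[OF u u_int] complex_mf_integral_eq_integral[OF v v_int]
    by (rule integral_dominated_convergence[OF dominated])
  ultimately show ?thesis by blast
qed

end
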